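(* Let $G$ be a finite group, $H\unlhd G$ and $g\in G$. If $\tilde\zeta_{2n}(g)$, $n\ge1$, denotes the number of elements $((h_1,g_1),\dots,(h_n,g_n))\in(H\times G)^n$ satisfying $[h_1,g_1]\cdots[h_n,g_n]=g$, then $\tilde\zeta_{2n}$ is a character of $G$ and $$\tilde\zeta_{2n}(g)=\sum_{\chi\in\operatorname{Irr}(G)}\frac{|G|^{n-1}|H|^n[\chi_H,\chi_H]^n}{\chi(1)^{2n-1}}\,\chi(g).$$
   Context: $[x,y]=xyx^{-1}y^{-1}$ for group elements $x,y$. $\operatorname{Irr}(G)$ is the set of irreducible complex characters of $G$; $\chi_H$ is the restriction of $\chi$ to $H$; $[\chi_H,\chi_H]$ is the usual inner product of class functions of $H$. "Character" means character of a complex representation. *)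

theory Defs
  imports Complex_Main "HOL-Algebra.Coset" "Jordan_Normal_Form.VS_Connect"
begin

definition GL :: "nat \<Rightarrow> complex mat monoid" where
  "GL d = units_of (ring_mat TYPE(complex) d ())"

text \<open>Representations have positive degree, so the zero function is not a character.\<close>

definition is_representation :: "('a, 'b) monoid_scheme \<Rightarrow> nat \<Rightarrow> ('a \<Rightarrow> complex mat) \<Rightarrow> bool" where
  "is_representation G d \<rho> \<longleftrightarrow> d > 0 \<and> \<rho> \<in> hom G (GL d)"

definition is_irreducible_representation ::
    "('a, 'b) monoid_scheme \<Rightarrow> nat \<Rightarrow> ('a \<Rightarrow> complex mat) \<Rightarrow> bool" where
  "is_irreducible_representation G d \<rho> \<longleftrightarrow>
     is_representation G d \<rho> \<and>
     (\<forall>W. VectorSpace.subspace class_ring W (module_vec TYPE(complex) d) \<longrightarrow>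
          (\<forall>x\<in>carrier G. \<forall>w\<in>W. \<rho> x *\<^sub>v w \<in> W) \<longrightarrow>
          W = {0\<^sub>v d} \<or> W = carrier_vec d)"

definition mat_trace :: "complex mat \<Rightarrow> complex" where
  "mat_trace A = (\<Sum>i<dim_row A. A $$ (i, i))"

text \<open>Class functions live on the carrier; they take the value \<open>undefined\<close> elsewhere,
  so that distinct members of \<open>Irr G\<close> differ at some group element.\<close>

definition character_of :: "('a, 'b) monoid_scheme \<Rightarrow> ('a \<Rightarrow> complex mat) \<Rightarrow> 'a \<Rightarrow> complex" where
  "character_of G \<rho> = (\<lambda>x\<in>carrier G. mat_trace (\<rho> x))"

definition is_character :: "('a, 'b) monoid_scheme \<Rightarrow> ('a \<Rightarrow> complex) \<Rightarrow> bool" where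
  "is_character G \<chi> \<longleftrightarrow> (\<exists>d \<rho>. is_representation G d \<rho> \<and> \<chi> = character_of G \<rho>)"

definition Irr :: "('a, 'b) monoid_scheme \<Rightarrow> ('a \<Rightarrow> complex) set" where
  "Irr G = {\<chi>. \<exists>d \<rho>. is_irreducible_representation G d \<rho> \<and> \<chi> = character_of G \<rho>}"

definition class_inner ::
    "('a, 'b) monoid_scheme \<Rightarrow> ('a \<Rightarrow> complex) \<Rightarrow> ('a \<Rightarrow> complex) \<Rightarrow> complex" where
  "class_inner G \<phi> \<psi> = (\<Sum>x\<in>carrier G. \<phi> x * cnj (\<psi> x)) / of_nat (Coset.order G)"

definition commutator :: "('a, 'b) monoid_scheme \<Rightarrow> 'a \<Rightarrow> 'a \<Rightarrow> 'a" where
  "commutator G x y = x \<otimes>\<^bsub>G\<^esub> y \<otimes>\<^bsub>G\<^esub> inv\<^bsub>G\<^esub> x \<otimes>\<^bsub>G\<^esub> inv\<^bsub>G\<^esub> y"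

definition commutator_product :: "('a, 'b) monoid_scheme \<Rightarrow> ('a \<times> 'a) list \<Rightarrow> 'a" where
  "commutator_product G ps = foldr (mult G) (map (\<lambda>(h, x). commutator G h x) ps) \<one>\<^bsub>G\<^esub>"

text \<open>\<open>zeta G H n\<close> is the function written zeta-tilde with index \<open>2 n\<close>.
  Elements of the \<open>n\<close>-fold power of \<open>H \<times> G\<close> are lists of length \<open>n\<close>.\<close>

definition zeta :: "('a, 'b) monoid_scheme \<Rightarrow> 'a set \<Rightarrow> nat \<Rightarrow> 'a \<Rightarrow> nat" where
  "zeta G H n g = card {ps. length ps = n \<and> set ps \<subseteq> H \<times> carrier G \<and> commutator_product G ps = g}"

end

theory Submission
  imports Defs "Jordan_Normal_Form.Spectral_Radius" "Jordan_Normal_Form.DL_Rank"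
    "HOL-Algebra.Multiplicative_Group"
begin

text \<open>
  For an irreducible representation \<open>\<rho>\<close> of degree \<open>d\<close> with character \<open>\<chi>\<close>, Schur's lemma turns every sum
  of values of \<open>\<rho>\<close> that is invariant under conjugation into a scalar. Summing \<open>\<rho> (h x h\<^sup>-\<^sup>1 x\<^sup>-\<^sup>1)\<close> over
  \<open>x\<close> in \<open>G\<close> gives \<open>|G| \<chi> (h\<^sup>-\<^sup>1) / d\<close> times \<open>\<rho> h\<close>, and summing that over the normal subgroup \<open>H\<close> gives
  the scalar \<open>c = |G| |H| [\<chi>\<^sub>H, \<chi>\<^sub>H] / d\<^sup>2\<close>. So the sum of \<open>\<chi> (p g\<^sup>-\<^sup>1)\<close> over all products \<open>p\<close> of
  \<open>n\<close> commutators is \<open>c ^ n * \<chi> (g\<^sup>-\<^sup>1)\<close>. Since the regular character \<open>\<Sum>\<chi>. \<chi> 1 * \<chi>\<close> is \<open>|G|\<close> at the identity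
  and zero elsewhere, weighting by \<open>\<chi> 1 / |G|\<close> and summing over \<open>Irr G\<close> counts the products equal
  to \<open>g\<close>; this is lemma \<open>zeta_formula\<close>.

  The coefficient of \<open>\<chi>\<close> is \<open>(|G| / d) ^ (n - 1) * (|H| [\<chi>\<^sub>H, \<chi>\<^sub>H] / d) ^ n\<close>, and \<open>|G| / d\<close> is the case
  \<open>H = G\<close> of the second factor. That factor is positive and rational, and it is an algebraic integer:
  grouping \<open>H\<close> into conjugacy classes \<open>K\<close> of \<open>G\<close> with representatives \<open>k\<close>, it is
  the sum of \<open>(|K| \<chi> k / d) * cnj (\<chi> k)\<close>, where both factors are algebraic integers (lemma
  \<open>norm_sum_algebraic_int\<close>). Hence every coefficient is a positive natural number, and a
  nonempty sum of characters is a character.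

  The character theory needed for this is developed from the definitions: Schur's lemma and
  orthogonality, the decomposition of characters into irreducible ones, the regular character, and
  character values as sums of roots of unity. Complete reducibility is not needed, because the
  trace of a block triangular matrix depends only on its diagonal blocks.
\<close>

section \<open>Traces and sums of matrices\<close>

lemma mat_trace_smult:
  assumes "A \<in> carrier_mat d d"
  shows "mat_trace (c \<cdot>\<^sub>m A) = c * mat_trace A"
  using assms by (auto simp: mat_trace_def sum_distrib_left)

lemma mat_trace_one: "mat_trace (1\<^sub>m d) = of_nat d"
  by (auto simp: mat_trace_def)

lemma mat_trace_mult:
  assumes "A \<in> carrier_mat n m" "B \<in> carrier_mat m n"
  shows "mat_trace (A * B) = (\<Sum>i<n. \<Sum>j<m. A $$ (i, j) * B $$ (j, i))"
  using assms by (auto simp: mat_trace_def scalar_prod_def lessThan_atLeast0 intro!: sum.cong)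

lemma mat_trace_mult_commute:
  assumes "A \<in> carrier_mat n m" "B \<in> carrier_mat m n"
  shows "mat_trace (A * B) = mat_trace (B * A)"
  unfolding mat_trace_mult[OF assms] mat_trace_mult[OF assms(2,1)]
  by (subst sum.swap) (simp add: mult.commute)

lemma mat_trace_conjugate:
  assumes "A \<in> carrier_mat n n" "P \<in> carrier_mat m n" "Q \<in> carrier_mat n m" "Q * P = 1\<^sub>m n"
  shows "mat_trace (P * A * Q) = mat_trace A"
proof -
  have "mat_trace (P * A * Q) = mat_trace (Q * (P * A))"
    using assms by (intro mat_trace_mult_commute) auto
  also have "Q * (P * A) = (Q * P) * A"
    using assms by (intro assoc_mult_mat[symmetric]) auto
  finally show ?thesis using assms by simp
qed

lemma mat_trace_four_block:
  assumes "A \<in> carrier_mat m m" "B \<in> carrier_mat m n" "C \<in> carrier_mat n m" "D \<in> carrier_mat n n"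
  shows "mat_trace (four_block_mat A B C D) = mat_trace A + mat_trace D"
proof -
  have "mat_trace (four_block_mat A B C D)
      = (\<Sum>i<m + n. if i < m then A $$ (i, i) else D $$ (i - m, i - m))"
    using assms by (auto simp: mat_trace_def intro!: sum.cong)
  also have "\<dots> = (\<Sum>i<m. A $$ (i, i)) + (\<Sum>i<n. D $$ (i, i))"
    by (simp add: lessThan_atLeast0 sum.atLeastLessThan_concat[of 0 m "m + n", symmetric]
        sum.shift_bounds_nat_ivl[of _ 0 m n, simplified add_0 add.commute[of n m]] del: sum.atLeastLessThan_concat)
  finally show ?thesis using assms by (simp add: mat_trace_def)
qed

text \<open>The product of two traces, written with matrix units so that averages become visible.\<close>

lemma mat_trace_times_mat_trace:
  assumes "A \<in> carrier_mat d d" "B \<in> carrier_mat e e"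
  shows "mat_trace A * mat_trace B
    = (\<Sum>i<d. \<Sum>j<e. (A * mat d e (\<lambda>(k, l). if k = i \<and> l = j then 1 else 0) * B) $$ (i, j))"
proof -
  have "(A * mat d e (\<lambda>(k, l). if k = i \<and> l = j then 1 else 0) * B) $$ (i, j) = A $$ (i, i) * B $$ (j, j)"
    if ij: "i < d" "j < e" for i j
  proof -
    let ?E = "mat d e (\<lambda>(k, l). if k = i \<and> l = j then 1 else 0) :: complex mat"
    have AE: "(A * ?E) $$ (i, l) = (if l = j then A $$ (i, i) else 0)" if "l < e" for l
    proof -
      have "(A * ?E) $$ (i, l) = (\<Sum>k = 0..<d. A $$ (i, k) * (if k = i \<and> l = j then 1 else 0))"
        using assms ij that by (auto simp: scalar_prod_def intro!: sum.cong)
      also have "\<dots> = (\<Sum>k = 0..<d. if k = i then (if l = j then A $$ (i, i) else 0) else 0)"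
        by (intro sum.cong) auto
      finally show ?thesis using ij by simp
    qed
    have "(A * ?E * B) $$ (i, j) = (\<Sum>l = 0..<e. (A * ?E) $$ (i, l) * B $$ (l, j))"
      by (subst index_mult_mat(1)) (use assms ij in \<open>auto simp: scalar_prod_def intro!: sum.cong\<close>)
    also have "\<dots> = (\<Sum>l = 0..<e. if l = j then A $$ (i, i) * B $$ (j, j) else 0)"
      by (intro sum.cong) (auto simp: AE simp del: index_mult_mat(1))
    finally show ?thesis using ij by simp
  qed
  then show ?thesis using assms by (simp add: mat_trace_def sum_product)
qed

text \<open>The sum of a family of matrices of the same size; matrices of all sizes share one type,
  so the size of the result is an argument.\<close>

definition mat_sum :: "nat \<Rightarrow> nat \<Rightarrow> ('i \<Rightarrow> complex mat) \<Rightarrow> 'i set \<Rightarrow> complex mat" where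
  "mat_sum nr nc f S = mat nr nc (\<lambda>ij. \<Sum>x\<in>S. f x $$ ij)"

lemma mat_sum_carrier [simp, intro]: "mat_sum nr nc f S \<in> carrier_mat nr nc"
  by (simp add: mat_sum_def)

lemma mat_sum_index [simp]:
  "i < nr \<Longrightarrow> j < nc \<Longrightarrow> mat_sum nr nc f S $$ (i, j) = (\<Sum>x\<in>S. f x $$ (i, j))"
  by (simp add: mat_sum_def)

lemma mat_sum_dim [simp]: "dim_row (mat_sum nr nc f S) = nr" "dim_col (mat_sum nr nc f S) = nc"
  by (simp_all add: mat_sum_def)

lemma mat_sum_cong:
  assumes "S = T" "\<And>x. x \<in> T \<Longrightarrow> f x = g x"
  shows "mat_sum nr nc f S = mat_sum nr nc g T"
  using assms by (auto simp: mat_sum_def)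

lemma mat_sum_reindex_bij:
  assumes "bij_betw h S T"
  shows "mat_sum nr nc (\<lambda>x. f (h x)) S = mat_sum nr nc f T"
  unfolding mat_sum_def using assms by (auto intro!: eq_matI sum.reindex_bij_betw)

lemma mat_sum_mult_left:
  assumes "A \<in> carrier_mat m nr" "\<And>x. x \<in> S \<Longrightarrow> f x \<in> carrier_mat nr nc"
  shows "A * mat_sum nr nc f S = mat_sum m nc (\<lambda>x. A * f x) S"
proof (rule eq_matI)
  fix i j assume "i < dim_row (mat_sum m nc (\<lambda>x. A * f x) S)" "j < dim_col (mat_sum m nc (\<lambda>x. A * f x) S)"
  then have ij: "i < m" "j < nc" by auto
  have "(A * mat_sum nr nc f S) $$ (i, j) = (\<Sum>k = 0..<nr. \<Sum>x\<in>S. A $$ (i, k) * f x $$ (k, j))"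
    using ij assms by (auto simp: scalar_prod_def sum_distrib_left intro!: sum.cong)
  also have "\<dots> = (\<Sum>x\<in>S. \<Sum>k = 0..<nr. A $$ (i, k) * f x $$ (k, j))"
    by (rule sum.swap)
  also have "\<dots> = mat_sum m nc (\<lambda>x. A * f x) S $$ (i, j)"
    using ij assms by (fastforce simp: scalar_prod_def intro!: sum.cong)
  finally show "(A * mat_sum nr nc f S) $$ (i, j) = mat_sum m nc (\<lambda>x. A * f x) S $$ (i, j)" .
qed (use assms in auto)

lemma mat_sum_mult_right:
  assumes "A \<in> carrier_mat nc m" "\<And>x. x \<in> S \<Longrightarrow> f x \<in> carrier_mat nr nc"
  shows "mat_sum nr nc f S * A = mat_sum nr m (\<lambda>x. f x * A) S"
proof (rule eq_matI)
  fix i j assume "i < dim_row (mat_sum nr m (\<lambda>x. f x * A) S)" "j < dim_col (mat_sum nr m (\<lambda>x. f x * A) S)"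
  then have ij: "i < nr" "j < m" by auto
  have "(mat_sum nr nc f S * A) $$ (i, j) = (\<Sum>k = 0..<nc. \<Sum>x\<in>S. f x $$ (i, k) * A $$ (k, j))"
    using ij assms by (auto simp: scalar_prod_def sum_distrib_right intro!: sum.cong)
  also have "\<dots> = (\<Sum>x\<in>S. \<Sum>k = 0..<nc. f x $$ (i, k) * A $$ (k, j))"
    by (rule sum.swap)
  also have "\<dots> = mat_sum nr m (\<lambda>x. f x * A) S $$ (i, j)"
    using ij assms by (fastforce simp: scalar_prod_def intro!: sum.cong)
  finally show "(mat_sum nr nc f S * A) $$ (i, j) = mat_sum nr m (\<lambda>x. f x * A) S $$ (i, j)" .
qed (use assms in auto)

lemma mat_trace_mat_sum:
  assumes "\<And>x. x \<in> S \<Longrightarrow> f x \<in> carrier_mat d d"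
  shows "mat_trace (mat_sum d d f S) = (\<Sum>x\<in>S. mat_trace (f x))"
proof -
  have "mat_trace (mat_sum d d f S) = (\<Sum>x\<in>S. \<Sum>i<d. f x $$ (i, i))"
    by (simp add: mat_trace_def sum.swap[of _ _ "{..<d}"])
  also have "\<dots> = (\<Sum>x\<in>S. mat_trace (f x))"
    using assms by (auto simp: mat_trace_def intro!: sum.cong)
  finally show ?thesis .
qed

section \<open>Representations by matrices\<close>

context group
begin

lemma is_representation_iff:
  "is_representation G d \<rho> \<longleftrightarrow> d > 0 \<and> (\<forall>x\<in>carrier G. \<rho> x \<in> carrier_mat d d) \<and>
     \<rho> \<one> = 1\<^sub>m d \<and> (\<forall>x\<in>carrier G. \<forall>y\<in>carrier G. \<rho> (x \<otimes> y) = \<rho> x * \<rho> y)"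
  (is "?L \<longleftrightarrow> ?R")
proof
  assume L: ?L
  then have hom: "\<rho> \<in> hom G (GL d)" and d: "d > 0"
    by (auto simp: is_representation_def)
  interpret M: ring "ring_mat TYPE(complex) d ()" by (rule ring_mat)
  have "group (GL d)" unfolding GL_def by (rule M.units_group)
  then interpret group_hom G "GL d" \<rho>
    using hom by (simp add: group_hom_def group_hom_axioms_def is_group)
  have "\<rho> x \<in> carrier_mat d d" if "x \<in> carrier G" for x
    using hom_closed[OF that] by (auto simp: GL_def units_of_def Units_def ring_mat_def)
  moreover have "\<rho> \<one> = 1\<^sub>m d"
    using hom_one by (simp add: GL_def units_of_def ring_mat_def)
  moreover have "\<rho> (x \<otimes> y) = \<rho> x * \<rho> y" if "x \<in> carrier G" "y \<in> carrier G" for x y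
    using hom_mult[OF that] by (simp add: GL_def units_of_def ring_mat_def)
  ultimately show ?R using d by blast
next
  assume R: ?R
  have "\<rho> x \<in> Units (ring_mat TYPE(complex) d ())" if x: "x \<in> carrier G" for x
  proof -
    have "\<rho> x * \<rho> (inv x) = 1\<^sub>m d" "\<rho> (inv x) * \<rho> x = 1\<^sub>m d"
      using R x by (metis inv_closed r_inv, metis inv_closed l_inv)
    then show ?thesis
      using R x unfolding Units_def by (auto simp: ring_mat_def)
  qed
  then show ?L
    using R by (auto simp: is_representation_def hom_def GL_def units_of_def ring_mat_def)
qed

lemma representationD:
  assumes "is_representation G d \<rho>"
  shows "d > 0" "\<And>x. x \<in> carrier G \<Longrightarrow> \<rho> x \<in> carrier_mat d d" "\<rho> \<one> = 1\<^sub>m d"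
    "\<And>x y. x \<in> carrier G \<Longrightarrow> y \<in> carrier G \<Longrightarrow> \<rho> (x \<otimes> y) = \<rho> x * \<rho> y"
  using assms by (auto simp: is_representation_iff)

lemma representation_inv_mult:
  assumes "is_representation G d \<rho>" "x \<in> carrier G"
  shows "\<rho> x * \<rho> (inv x) = 1\<^sub>m d" "\<rho> (inv x) * \<rho> x = 1\<^sub>m d"
  using representationD[OF assms(1)] assms(2) by (metis inv_closed r_inv, metis inv_closed l_inv)

lemma representation_pow:
  assumes "is_representation G d \<rho>" "x \<in> carrier G"
  shows "\<rho> (x [^] (k::nat)) = \<rho> x ^\<^sub>m k"
  using representationD[OF assms(1)] assms(2) by (induction k) auto

lemma character_of_apply: "x \<in> carrier G \<Longrightarrow> character_of G \<rho> x = mat_trace (\<rho> x)"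
  by (simp add: character_of_def)

lemma character_of_one: "is_representation G d \<rho> \<Longrightarrow> character_of G \<rho> \<one> = of_nat d"
  by (simp add: character_of_def representationD mat_trace_one)

lemma character_of_conj:
  assumes "is_representation G d \<rho>" "x \<in> carrier G" "y \<in> carrier G"
  shows "character_of G \<rho> (x \<otimes> y \<otimes> inv x) = character_of G \<rho> y"
  using assms representationD[OF assms(1)] representation_inv_mult[OF assms(1,2)]
    mat_trace_conjugate[of "\<rho> y" d "\<rho> x" d "\<rho> (inv x)"]
  by (simp add: character_of_def)

lemma irreducible_representationD:
  assumes "is_irreducible_representation G d \<rho>"
  shows "is_representation G d \<rho>"
    "\<And>W. \<lbrakk>VectorSpace.subspace class_ring W (module_vec TYPE(complex) d);
      \<And>x w. x \<in> carrier G \<Longrightarrow> w \<in> W \<Longrightarrow> \<rho> x *\<^sub>v w \<in> W\<rbrakk> \<Longrightarrow> W = {0\<^sub>v d} \<or> W = carrier_vec d"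
  using assms by (auto simp: is_irreducible_representation_def)

end

section \<open>Schur's lemma\<close>

lemma mult_mat_zero_vec:
  assumes "A \<in> carrier_mat n m"
  shows "A *\<^sub>v 0\<^sub>v m = (0\<^sub>v n :: complex vec)"
  using assms by (intro eq_vecI) auto

lemma zero_mult_mat_vec:
  assumes "v \<in> carrier_vec m"
  shows "0\<^sub>m n m *\<^sub>v v = (0\<^sub>v n :: complex vec)"
  using assms by (intro eq_vecI) auto

lemma smult_mult_mat_vec:
  assumes "A \<in> carrier_mat n m" "v \<in> carrier_vec m"
  shows "(c \<cdot>\<^sub>m A) *\<^sub>v v = c \<cdot>\<^sub>v (A *\<^sub>v v :: complex vec)"
  using assms by (intro eq_vecI) auto

lemma subspace_vecI:
  assumes "W \<subseteq> carrier_vec d" "0\<^sub>v d \<in> W"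
    "\<And>v w. v \<in> W \<Longrightarrow> w \<in> W \<Longrightarrow> v + w \<in> W" "\<And>c v. v \<in> W \<Longrightarrow> c \<cdot>\<^sub>v v \<in> W"
  shows "VectorSpace.subspace class_ring W (module_vec TYPE(complex) d)"
  using assms vec_vs[of d, where 'a = complex] vec_module[of d, where 'a = complex]
  by (auto simp: VectorSpace.subspace_def submodule_def module_vec_simps)

lemma subspace_kernel:
  assumes X: "X \<in> carrier_mat m d"
  shows "VectorSpace.subspace class_ring {v \<in> carrier_vec d. X *\<^sub>v v = 0\<^sub>v m} (module_vec TYPE(complex) d)"
  using X by (intro subspace_vecI) (auto simp: mult_add_distrib_mat_vec mult_mat_vec)

lemma subspace_image:
  assumes X: "X \<in> carrier_mat d m"
  shows "VectorSpace.subspace class_ring ((*\<^sub>v) X ` carrier_vec m) (module_vec TYPE(complex) d)"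
proof (rule subspace_vecI)
  show "(*\<^sub>v) X ` carrier_vec m \<subseteq> carrier_vec d" using X by auto
  show "0\<^sub>v d \<in> (*\<^sub>v) X ` carrier_vec m" using X by (intro image_eqI[of _ _ "0\<^sub>v m"]) auto
next
  fix v w assume "v \<in> (*\<^sub>v) X ` carrier_vec m" "w \<in> (*\<^sub>v) X ` carrier_vec m"
  then obtain a b where "a \<in> carrier_vec m" "b \<in> carrier_vec m" "v = X *\<^sub>v a" "w = X *\<^sub>v b" by auto
  then show "v + w \<in> (*\<^sub>v) X ` carrier_vec m"
    using X by (intro image_eqI[of _ _ "a + b"]) (auto simp: mult_add_distrib_mat_vec)
next
  fix c v assume "v \<in> (*\<^sub>v) X ` carrier_vec m"
  then obtain a where "a \<in> carrier_vec m" "v = X *\<^sub>v a" by auto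
  then show "c \<cdot>\<^sub>v v \<in> (*\<^sub>v) X ` carrier_vec m"
    using X by (intro image_eqI[of _ _ "c \<cdot>\<^sub>v a"]) (auto simp: mult_mat_vec)
qed

lemma mat_eq_zeroI:
  fixes X :: "complex mat"
  assumes X: "X \<in> carrier_mat d e" and *: "\<And>v. v \<in> carrier_vec e \<Longrightarrow> X *\<^sub>v v = 0\<^sub>v d"
  shows "X = 0\<^sub>m d e"
proof (rule eq_matI)
  fix i j assume "i < dim_row (0\<^sub>m d e :: complex mat)" "j < dim_col (0\<^sub>m d e :: complex mat)"
  then have ij: "i < d" "j < e" by auto
  have "X $$ (i, j) = (X *\<^sub>v unit_vec e j) $ i" using X ij by simp
  then show "X $$ (i, j) = 0\<^sub>m d e $$ (i, j)" using *[of "unit_vec e j"] ij by simp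
qed (use X in auto)

context group
begin

text \<open>The degrees \<open>d\<close> and \<open>e\<close> are not assumed equal: kernel and image of \<open>X\<close> are invariant subspaces,
  so \<open>X\<close> is injective and surjective, and a right inverse built from preimages of the unit vectors is
  also a left inverse.\<close>

theorem Schur_invertible:
  assumes \<rho>: "is_irreducible_representation G d \<rho>" and \<sigma>: "is_irreducible_representation G e \<sigma>"
    and X: "X \<in> carrier_mat d e" and comm: "\<And>x. x \<in> carrier G \<Longrightarrow> \<rho> x * X = X * \<sigma> x"
    and "X \<noteq> 0\<^sub>m d e"
  shows "\<exists>Y\<in>carrier_mat e d. X * Y = 1\<^sub>m d \<and> Y * X = 1\<^sub>m e"
proof -
  note r = representationD[OF irreducible_representationD(1)[OF \<rho>]]
  note s = representationD[OF irreducible_representationD(1)[OF \<sigma>]]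
  have comm': "\<rho> x *\<^sub>v (X *\<^sub>v v) = X *\<^sub>v (\<sigma> x *\<^sub>v v)" if "x \<in> carrier G" "v \<in> carrier_vec e" for x v
    using comm[OF that(1)] that r(2) s(2) X by (metis assoc_mult_mat_vec)
  let ?K = "{v \<in> carrier_vec e. X *\<^sub>v v = 0\<^sub>v d}"
  let ?I = "(*\<^sub>v) X ` carrier_vec e"
  have "?K = {0\<^sub>v e} \<or> ?K = carrier_vec e"
  proof (rule irreducible_representationD(2)[OF \<sigma> subspace_kernel[OF X]])
    fix x w assume x: "x \<in> carrier G" and "w \<in> ?K"
    then show "\<sigma> x *\<^sub>v w \<in> ?K" using s(2)[OF x] comm'[of x w] mult_mat_zero_vec[OF r(2)[OF x]] by auto
  qed
  moreover have "?K \<noteq> carrier_vec e" using mat_eq_zeroI[OF X] \<open>X \<noteq> 0\<^sub>m d e\<close> by blast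
  ultimately have ker: "?K = {0\<^sub>v e}" by blast
  have "?I = {0\<^sub>v d} \<or> ?I = carrier_vec d"
  proof (rule irreducible_representationD(2)[OF \<rho> subspace_image[OF X]])
    fix x w assume x: "x \<in> carrier G" and "w \<in> ?I"
    then obtain v where "v \<in> carrier_vec e" "w = X *\<^sub>v v" by auto
    then show "\<rho> x *\<^sub>v w \<in> ?I" using x s(2)[OF x] comm'[of x v] by auto
  qed
  moreover have "?I \<noteq> {0\<^sub>v d}" using mat_eq_zeroI[OF X] \<open>X \<noteq> 0\<^sub>m d e\<close> by blast
  ultimately have im: "?I = carrier_vec d" by blast
  have "\<forall>i. \<exists>v. i < d \<longrightarrow> v \<in> carrier_vec e \<and> X *\<^sub>v v = unit_vec d i"
    using im by (metis (no_types, lifting) image_iff unit_vec_carrier)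
  then obtain f where f: "\<And>i. i < d \<Longrightarrow> f i \<in> carrier_vec e \<and> X *\<^sub>v f i = unit_vec d i" by metis
  define Y where "Y = mat e d (\<lambda>(i, j). f j $ i)"
  have Y: "Y \<in> carrier_mat e d" by (simp add: Y_def)
  have colY: "col Y j = f j" if "j < d" for j
    using f[OF that] that by (auto simp: Y_def)
  have XY: "X * Y = 1\<^sub>m d"
  proof (rule eq_matI)
    fix i j assume "i < dim_row (1\<^sub>m d :: complex mat)" "j < dim_col (1\<^sub>m d :: complex mat)"
    then have ij: "i < d" "j < d" by auto
    have "(X * Y) $$ (i, j) = (X *\<^sub>v f j) $ i" using ij X Y colY by simp
    then show "(X * Y) $$ (i, j) = 1\<^sub>m d $$ (i, j)" using ij f[of j] by simp
  qed (use X Y in auto)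
  \<comment> \<open>\<open>X\<close> is injective and maps every column of \<open>Y * X - 1\<close> to zero.\<close>
  have "Y * X - 1\<^sub>m e = 0\<^sub>m e e"
  proof (rule mat_eq_zeroI)
    show "Y * X - 1\<^sub>m e \<in> carrier_mat e e" using X Y by auto
    fix v :: "complex vec" assume v: "v \<in> carrier_vec e"
    have "X *\<^sub>v ((Y * X - 1\<^sub>m e) *\<^sub>v v) = (X * (Y * X - 1\<^sub>m e)) *\<^sub>v v"
      using X Y v by (intro assoc_mult_mat_vec[symmetric]) auto
    also have "X * (Y * X - 1\<^sub>m e) = X * (Y * X) - X * 1\<^sub>m e"
      using X Y by (intro mult_minus_distrib_mat) auto
    also have "X * (Y * X) = X"
      using X Y XY assoc_mult_mat[of X d e Y d X e] by simp
    finally have "X *\<^sub>v ((Y * X - 1\<^sub>m e) *\<^sub>v v) = 0\<^sub>v d"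
      using X v zero_mult_mat_vec[OF v] by simp
    moreover have "(Y * X - 1\<^sub>m e) *\<^sub>v v \<in> carrier_vec e"
      using X by (intro carrier_vecI) auto
    ultimately have "(Y * X - 1\<^sub>m e) *\<^sub>v v \<in> ?K" by blast
    then show "(Y * X - 1\<^sub>m e) *\<^sub>v v = 0\<^sub>v e" unfolding ker by blast
  qed
  moreover have "Y * X = (Y * X - 1\<^sub>m e) + 1\<^sub>m e" using X Y by (intro eq_matI) auto
  ultimately have "Y * X = 1\<^sub>m e" by simp
  then show ?thesis using XY Y by blast
qed

corollary Schur_same_character:
  assumes \<rho>: "is_irreducible_representation G d \<rho>" and \<sigma>: "is_irreducible_representation G e \<sigma>"
    and X: "X \<in> carrier_mat d e" and comm: "\<And>x. x \<in> carrier G \<Longrightarrow> \<rho> x * X = X * \<sigma> x"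
    and "X \<noteq> 0\<^sub>m d e"
  shows "character_of G \<rho> = character_of G \<sigma>"
proof -
  obtain Y where Y: "Y \<in> carrier_mat e d" "X * Y = 1\<^sub>m d" "Y * X = 1\<^sub>m e"
    using Schur_invertible[OF assms] by blast
  note r = representationD[OF irreducible_representationD(1)[OF \<rho>]]
  note s = representationD[OF irreducible_representationD(1)[OF \<sigma>]]
  have "mat_trace (\<rho> x) = mat_trace (\<sigma> x)" if x: "x \<in> carrier G" for x
  proof -
    have "\<rho> x = \<rho> x * (X * Y)" using Y r(2)[OF x] by simp
    also have "\<dots> = X * \<sigma> x * Y" using Y(1) r x X comm[OF x] by (metis assoc_mult_mat)
    finally show ?thesis using mat_trace_conjugate[of "\<sigma> x" e X d Y] s x X Y by simp
  qed
  then show ?thesis by (auto simp: character_of_def)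
qed

theorem Schur_scalar:
  assumes \<rho>: "is_irreducible_representation G d \<rho>"
    and X: "X \<in> carrier_mat d d" and comm: "\<And>x. x \<in> carrier G \<Longrightarrow> \<rho> x * X = X * \<rho> x"
  shows "X = (mat_trace X / of_nat d) \<cdot>\<^sub>m 1\<^sub>m d"
proof -
  note r = representationD[OF irreducible_representationD(1)[OF \<rho>]]
  obtain c where "eigenvalue X c"
    using spectrum_non_empty[OF X] r(1) by (auto simp: spectrum_def)
  then obtain v where v: "v \<in> carrier_vec d" "v \<noteq> 0\<^sub>v d" "X *\<^sub>v v = c \<cdot>\<^sub>v v"
    using X by (auto simp: eigenvalue_def eigenvector_def)
  \<comment> \<open>\<open>Z\<close> commutes with the representation but kills an eigenvector, so it is not invertible.\<close>
  define Z where "Z = X - c \<cdot>\<^sub>m 1\<^sub>m d"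
  have Z: "Z \<in> carrier_mat d d" using X by (auto simp: Z_def)
  have Zcomm: "\<rho> x * Z = Z * \<rho> x" if x: "x \<in> carrier G" for x
  proof -
    have "\<rho> x * Z = \<rho> x * X - \<rho> x * (c \<cdot>\<^sub>m 1\<^sub>m d)"
      unfolding Z_def using r x X by (intro mult_minus_distrib_mat) auto
    moreover have "Z * \<rho> x = X * \<rho> x - (c \<cdot>\<^sub>m 1\<^sub>m d) * \<rho> x"
      unfolding Z_def using r x X by (intro minus_mult_distrib_mat) auto
    ultimately show ?thesis
      using comm[OF x] r(2)[OF x]
          mult_smult_distrib[of "\<rho> x" d d "1\<^sub>m d" d c]
          mult_smult_assoc_mat[of "1\<^sub>m d" d d "\<rho> x" d c] by simp
  qed
  have Zv: "Z *\<^sub>v v = 0\<^sub>v d"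
    using X v by (auto simp: Z_def minus_mult_distrib_mat_vec smult_mult_mat_vec[of "1\<^sub>m d" d d])
  have "Z = 0\<^sub>m d d"
  proof (rule ccontr)
    assume "Z \<noteq> 0\<^sub>m d d"
    then obtain Y where Y: "Y \<in> carrier_mat d d" "Y * Z = 1\<^sub>m d"
      using Schur_invertible[OF \<rho> \<rho> Z Zcomm] by blast
    then have "v = (Y * Z) *\<^sub>v v" using v by simp
    also have "\<dots> = Y *\<^sub>v (Z *\<^sub>v v)" using Y Z v by (intro assoc_mult_mat_vec) auto
    also have "\<dots> = 0\<^sub>v d" unfolding Zv by (rule mult_mat_zero_vec[OF Y(1)])
    finally show False using v(2) by contradiction
  qed
  moreover have "X = Z + c \<cdot>\<^sub>m 1\<^sub>m d" using X by (intro eq_matI) (auto simp: Z_def)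
  ultimately have Xc: "X = c \<cdot>\<^sub>m 1\<^sub>m d" by simp
  then have "mat_trace X = c * of_nat d" by (simp add: mat_trace_smult[of _ d] mat_trace_one)
  then show ?thesis using Xc r(1) by simp
qed

end

section \<open>Orthogonality of irreducible characters\<close>

text \<open>A finite group, so that averaging over the whole group is possible.\<close>

locale fin_group = group G for G (structure) +
  assumes fin: "finite (carrier G)"
begin

lemma order_pos: "Coset.order G > 0"
  using fin one_closed by (auto simp: Coset.order_def card_gt_0_iff)

lemma bij_betw_mult_left: "y \<in> carrier G \<Longrightarrow> bij_betw (\<lambda>x. y \<otimes> x) (carrier G) (carrier G)"
  by (rule bij_betw_byWitness[where f' = "\<lambda>x. inv y \<otimes> x"]) (auto simp: m_assoc[symmetric])

text \<open>Averaging an arbitrary matrix over the group produces an intertwiner.\<close>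

lemma average_intertwines:
  assumes \<rho>: "is_representation G d \<rho>" and \<sigma>: "is_representation G e \<sigma>"
    and X: "X \<in> carrier_mat d e" and y: "y \<in> carrier G"
  defines "T \<equiv> mat_sum d e (\<lambda>x. \<rho> x * X * \<sigma> (inv x)) (carrier G)"
  shows "\<rho> y * T = T * \<sigma> y"
proof -
  note r = representationD[OF \<rho>] and s = representationD[OF \<sigma>]
  have c: "\<rho> x * X * \<sigma> (inv x) \<in> carrier_mat d e" if "x \<in> carrier G" for x
    using r s X that by (meson inv_closed mult_carrier_mat)
  have "\<rho> y * T = mat_sum d e (\<lambda>x. \<rho> y * (\<rho> x * X * \<sigma> (inv x))) (carrier G)"
    unfolding T_def using r y c by (intro mat_sum_mult_left) auto
  also have "\<dots> = mat_sum d e (\<lambda>x. \<rho> (y \<otimes> x) * X * \<sigma> (inv (y \<otimes> x)) * \<sigma> y) (carrier G)"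
  proof (rule mat_sum_cong)
    fix x assume x: "x \<in> carrier G"
    have s1: "\<sigma> (inv (y \<otimes> x)) * \<sigma> y = \<sigma> (inv x)"
      using x y s(4)[of "inv (y \<otimes> x)" y] by (simp add: inv_mult_group m_assoc)
    have r1: "\<rho> (y \<otimes> x) * X = \<rho> y * (\<rho> x * X)"
      using assoc_mult_mat[OF r(2)[OF y] r(2)[OF x] X] r(4)[OF y x] by simp
    have rx: "\<rho> x * X \<in> carrier_mat d e" "\<rho> (y \<otimes> x) * X \<in> carrier_mat d e"
      using r(2)[of x] r(2)[of "y \<otimes> x"] X x y by auto
    have "\<rho> (y \<otimes> x) * X * \<sigma> (inv (y \<otimes> x)) * \<sigma> y
        = \<rho> (y \<otimes> x) * X * (\<sigma> (inv (y \<otimes> x)) * \<sigma> y)"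
      by (rule assoc_mult_mat[OF rx(2) s(2) s(2)]) (use x y in auto)
    also have "\<dots> = \<rho> y * (\<rho> x * X) * \<sigma> (inv x)" by (simp only: s1 r1)
    also have "\<dots> = \<rho> y * (\<rho> x * X * \<sigma> (inv x))"
      by (rule assoc_mult_mat[OF r(2)[OF y] rx(1) s(2)]) (use x in auto)
    finally show "\<rho> y * (\<rho> x * X * \<sigma> (inv x))
      = \<rho> (y \<otimes> x) * X * \<sigma> (inv (y \<otimes> x)) * \<sigma> y" by (rule sym)
  qed simp
  also have "\<dots> = mat_sum d e (\<lambda>x. \<rho> x * X * \<sigma> (inv x) * \<sigma> y) (carrier G)"
    by (rule mat_sum_reindex_bij[OF bij_betw_mult_left[OF y], of d e "\<lambda>x. \<rho> x * X * \<sigma> (inv x) * \<sigma> y"])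
  also have "\<dots> = T * \<sigma> y"
    unfolding T_def using s y c by (intro mat_sum_mult_right[symmetric]) auto
  finally show ?thesis .
qed

lemma average_scalar:
  assumes \<rho>: "is_irreducible_representation G d \<rho>" and X: "X \<in> carrier_mat d d"
  shows "mat_sum d d (\<lambda>x. \<rho> x * X * \<rho> (inv x)) (carrier G)
    = (of_nat (Coset.order G) * mat_trace X / of_nat d) \<cdot>\<^sub>m 1\<^sub>m d"
proof -
  let ?T = "mat_sum d d (\<lambda>x. \<rho> x * X * \<rho> (inv x)) (carrier G)"
  note rep = irreducible_representationD(1)[OF \<rho>]
  note r = representationD[OF rep]
  have c: "\<rho> x * X * \<rho> (inv x) \<in> carrier_mat d d" if "x \<in> carrier G" for x
    using r X that by (meson inv_closed mult_carrier_mat)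
  have "mat_trace ?T = (\<Sum>x\<in>carrier G. mat_trace (\<rho> x * X * \<rho> (inv x)))"
    using c by (rule mat_trace_mat_sum)
  also have "\<dots> = (\<Sum>x\<in>carrier G. mat_trace X)"
    using r(2) representation_inv_mult[OF rep] X by (intro sum.cong mat_trace_conjugate[of _ d _ d]) auto
  finally have "mat_trace ?T = of_nat (Coset.order G) * mat_trace X" by (simp add: Coset.order_def)
  then show ?thesis
    using Schur_scalar[OF \<rho> mat_sum_carrier average_intertwines[OF rep rep X]] by simp
qed

text \<open>Expanding both traces with matrix units turns the sum into entries of averaged matrix units,
  which are scalar for equal characters and zero otherwise.\<close>

theorem irreducible_orthogonality:
  assumes \<rho>: "is_irreducible_representation G d \<rho>" and \<sigma>: "is_irreducible_representation G e \<sigma>"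
  shows "(\<Sum>x\<in>carrier G. character_of G \<rho> x * character_of G \<sigma> (inv x))
    = (if character_of G \<rho> = character_of G \<sigma> then of_nat (Coset.order G) else 0)"
proof -
  note rr = irreducible_representationD(1)[OF \<rho>] and rs = irreducible_representationD(1)[OF \<sigma>]
  note r = representationD[OF rr] and s = representationD[OF rs]
  define E :: "nat \<Rightarrow> nat \<Rightarrow> nat \<Rightarrow> complex mat" where
    "E e' i j = mat d e' (\<lambda>(k, l). if k = i \<and> l = j then 1 else 0)" for e' i j
  have E: "E e' i j \<in> carrier_mat d e'" for e' i j by (simp add: E_def)
  have expand: "(\<Sum>x\<in>carrier G. character_of G \<rho> x * character_of G \<tau> (inv x))
      = (\<Sum>i<d. \<Sum>j<e'. mat_sum d e' (\<lambda>x. \<rho> x * E e' i j * \<tau> (inv x)) (carrier G) $$ (i, j))"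
    if \<tau>: "is_representation G e' \<tau>" for e' \<tau>
  proof -
    note t = representationD[OF \<tau>]
    have "(\<Sum>x\<in>carrier G. character_of G \<rho> x * character_of G \<tau> (inv x))
      = (\<Sum>x\<in>carrier G. \<Sum>i<d. \<Sum>j<e'. (\<rho> x * E e' i j * \<tau> (inv x)) $$ (i, j))"
      unfolding E_def using r(2) t(2)
      by (intro sum.cong) (auto simp: character_of_def mat_trace_times_mat_trace[of _ d _ e'])
    also have "\<dots> = (\<Sum>i<d. \<Sum>j<e'. \<Sum>x\<in>carrier G. (\<rho> x * E e' i j * \<tau> (inv x)) $$ (i, j))"
      by (subst sum.swap) (simp add: sum.swap[of _ "carrier G"])
    finally show ?thesis by simp
  qed
  show ?thesis
  proof (cases "character_of G \<rho> = character_of G \<sigma>")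
    case True
    have "mat_trace (E d i j) = (if i = j then 1 else 0)" if "i < d" for i j
      using that by (auto simp: E_def mat_trace_def)
    then have "mat_sum d d (\<lambda>x. \<rho> x * E d i j * \<rho> (inv x)) (carrier G) $$ (i, j)
        = (if i = j then of_nat (Coset.order G) / of_nat d else 0)" if "i < d" "j < d" for i j
      using that by (simp add: average_scalar[OF \<rho> E] del: mat_sum_index)
    then have "(\<Sum>x\<in>carrier G. character_of G \<rho> x * character_of G \<rho> (inv x))
        = (\<Sum>i<d. \<Sum>j<d. if i = j then of_nat (Coset.order G) / of_nat d else 0)"
      by (simp add: expand[OF rr] del: mat_sum_index)
    also have "\<dots> = of_nat (Coset.order G)" using r(1) by simp
    finally show ?thesis using True by simp
  next
    case False
    have "mat_sum d e (\<lambda>x. \<rho> x * E e i j * \<sigma> (inv x)) (carrier G) = 0\<^sub>m d e" for i j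
      using Schur_same_character[OF \<rho> \<sigma> mat_sum_carrier average_intertwines[OF rr rs E]] False by blast
    then show ?thesis using False by (simp add: expand[OF rs] del: mat_sum_index)
  qed
qed

end

section \<open>Every character is a sum of irreducible characters\<close>

lemma subspace_vecD:
  assumes "VectorSpace.subspace class_ring W (module_vec TYPE(complex) d)"
  shows "W \<subseteq> carrier_vec d" "0\<^sub>v d \<in> W"
    "\<And>v w. v \<in> W \<Longrightarrow> w \<in> W \<Longrightarrow> v + w \<in> W" "\<And>c v. v \<in> W \<Longrightarrow> c \<cdot>\<^sub>v v \<in> W"
  using assms by (auto simp: VectorSpace.subspace_def submodule_def module_vec_simps)

text \<open>A basis of the whole space whose first \<open>k\<close> vectors form a basis of a given subspace, recorded as
  an invertible matrix \<open>P\<close> with the basis vectors as columns. The inverse \<open>Q\<close> computes coordinates, so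
  on the subspace only the first \<open>k\<close> of them can be nonzero.\<close>

lemma subspace_adapted_basis:
  assumes W: "VectorSpace.subspace class_ring W (module_vec TYPE(complex) d)"
  shows "\<exists>k P Q. k \<le> d \<and> P \<in> carrier_mat d d \<and> Q \<in> carrier_mat d d \<and> P * Q = 1\<^sub>m d \<and> Q * P = 1\<^sub>m d \<and>
    (k = 0 \<longrightarrow> W = {0\<^sub>v d}) \<and> (k = d \<longrightarrow> W = carrier_vec d) \<and> (\<forall>j<k. col P j \<in> W) \<and> (\<forall>w\<in>W. \<forall>i. k \<le> i \<longrightarrow> i < d \<longrightarrow> (Q *\<^sub>v w) $ i = 0)"
proof -
  interpret V: vec_space "TYPE(complex)" d .
  have sub: "LinearCombinations.submodule class_ring W (module_vec TYPE(complex) d)"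
    using W by (simp add: VectorSpace.subspace_def)
  note WC = subspace_vecD(1)[OF W]
  have bound: "finite S \<and> card S \<le> d" if "S \<subseteq> carrier_vec d" "V.lin_indpt S" for S
    using V.li_le_dim[OF V.fin_dim] that V.dim_is_n by auto
  have "\<exists>A. finite A \<and> maximal A (\<lambda>S. S \<subseteq> W \<and> V.lin_indpt S)"
  proof (rule maximal_exists)
    show "finite A \<and> card A \<le> d" if "A \<subseteq> W \<and> V.lin_indpt A" for A
      using that WC bound by blast
    show "{} \<subseteq> W \<and> V.lin_indpt {}" by (auto simp: V.lin_dep_def)
  qed
  then obtain A where A: "finite A" "maximal A (\<lambda>S. S \<subseteq> W \<and> V.lin_indpt S)" by blast
  then have AW: "A \<subseteq> W" and Ali: "V.lin_indpt A" by (auto simp: maximal_def)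
  have spanA: "W \<subseteq> V.span A"
  proof (rule ccontr)
    assume "\<not> W \<subseteq> V.span A"
    then obtain w where w: "w \<in> W" "w \<notin> V.span A" by blast
    have "A \<subseteq> V.span A" using AW WC by (intro V.in_own_span) auto
    then have "w \<notin> A" using w by blast
    then have "V.lin_indpt (A \<union> {w})"
      using V.lin_dep_iff_in_span[of A w] AW WC Ali w by auto
    then have "A \<union> {w} = A" using A(2) AW w(1) unfolding maximal_def by blast
    then show False using \<open>w \<notin> A\<close> by blast
  qed
  have "\<exists>B. finite B \<and> maximal B (\<lambda>S. A \<subseteq> S \<and> S \<subseteq> carrier_vec d \<and> V.lin_indpt S)"
  proof (rule maximal_exists)
    show "finite S \<and> card S \<le> d" if "A \<subseteq> S \<and> S \<subseteq> carrier_vec d \<and> V.lin_indpt S" for S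
      using that bound by blast
    show "A \<subseteq> A \<and> A \<subseteq> carrier_vec d \<and> V.lin_indpt A" using AW WC Ali by blast
  qed
  then obtain B where "finite B" "maximal B (\<lambda>S. A \<subseteq> S \<and> S \<subseteq> carrier_vec d \<and> V.lin_indpt S)"
    by blast
  then have "finite B \<and> A \<subseteq> B \<and> maximal B (\<lambda>S. S \<subseteq> carrier_vec d \<and> V.lin_indpt S)"
    unfolding maximal_def by (meson order_trans)
  then obtain B where B: "finite B" "A \<subseteq> B" "maximal B (\<lambda>S. S \<subseteq> carrier_vec d \<and> V.lin_indpt S)" by blast
  then have BC: "B \<subseteq> carrier_vec d" and Bli: "V.lin_indpt B" by (auto simp: maximal_def)
  have "V.basis B" using B(3) by (intro V.max_li_is_basis) simp
  then have cardB: "card B = d" using V.dim_basis[OF B(1)] V.dim_is_n by simp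
  obtain as where as: "set as = A" "distinct as" using A(1) finite_distinct_list by blast
  obtain bs where bs: "set bs = B - A" "distinct bs" using B(1) finite_distinct_list by (metis finite_Diff)
  have len: "length (as @ bs) = d"
    using distinct_card[of "as @ bs"] as bs cardB B(2) by (auto simp: Un_absorb1)
  define P where "P = mat_of_cols d (as @ bs)"
  have P: "P \<in> carrier_mat d d" using len unfolding P_def by (metis mat_of_cols_carrier(1))
  have colsP: "cols P = as @ bs"
    unfolding P_def using as bs BC AW WC by (intro cols_mat_of_cols) auto
  have "V.rank P = d"
    using P colsP as bs B(2) Bli by (intro V.lin_indpt_full_rank) (auto simp: Un_absorb1)
  then have "det P \<noteq> 0" using V.det_rank_iff[OF P] by blast
  then obtain Q where Q: "Q \<in> carrier_mat d d" "P * Q = 1\<^sub>m d" "Q * P = 1\<^sub>m d"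
    using det_non_zero_imp_unit[OF P, of "()"] by (auto simp: Units_def ring_mat_def)
  have "col P j \<in> W" if "j < length as" for j
  proof -
    have "col P j = cols P ! j" using that len P by simp
    then show ?thesis using that as AW by (auto simp: colsP nth_append)
  qed
  moreover have "(Q *\<^sub>v w) $ i = 0" if w: "w \<in> W" and i: "length as \<le> i" "i < d" for w i
  proof -
    have asC: "set as \<subseteq> carrier_vec d" using as AW WC by auto
    have "w \<in> V.span_list as" using w spanA V.span_list_as_span[OF asC] as by auto
    then obtain c where "w = V.lincomb_list c as" by (auto simp: V.span_list_def)
    then have "w = mat_of_cols d as *\<^sub>v vec (length as) c"
      using V.lincomb_list_as_mat_mult[of as c] asC carrier_vecD by blast
    also have "\<dots> = P *\<^sub>v vec d (\<lambda>j. if j < length as then c j else 0)"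
    proof (rule eq_vecI)
      fix i assume "i < dim_vec (P *\<^sub>v vec d (\<lambda>j. if j < length as then c j else 0))"
      then have i: "i < d" using P by simp
      have "(P *\<^sub>v vec d (\<lambda>j. if j < length as then c j else 0)) $ i
          = (\<Sum>j = 0..<d. (as @ bs) ! j $ i * (if j < length as then c j else 0))"
        using i len by (auto simp: P_def scalar_prod_def mat_of_cols_def intro!: sum.cong)
      also have "\<dots> = (\<Sum>j = 0..<length as. as ! j $ i * c j)"
        using len by (intro sum.mono_neutral_cong_right) (auto simp: nth_append)
      also have "\<dots> = (mat_of_cols d as *\<^sub>v vec (length as) c) $ i"
        using i by (auto simp: scalar_prod_def mat_of_cols_def intro!: sum.cong)
      finally show "(mat_of_cols d as *\<^sub>v vec (length as) c) $ i
        = (P *\<^sub>v vec d (\<lambda>j. if j < length as then c j else 0)) $ i" by simp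
    qed (use P in simp)
    finally have w: "w = P *\<^sub>v vec d (\<lambda>j. if j < length as then c j else 0)" .
    have "Q *\<^sub>v w = (Q * P) *\<^sub>v vec d (\<lambda>j. if j < length as then c j else 0)"
      unfolding w using P Q(1) by (intro assoc_mult_mat_vec[symmetric]) auto
    then show ?thesis using Q(3) i by simp
  qed
  moreover have "length as \<le> d" using len by simp
  moreover have "W = {0\<^sub>v d}" if "length as = 0"
    using that spanA as subspace_vecD(2)[OF W] V.span_empty by auto
  moreover have "W = carrier_vec d" if "length as = d"
  proof -
    have "B = A" using that len bs B(2) by auto
    then have "V.span A = carrier_vec d" using \<open>V.basis B\<close> by (simp add: V.basis_def)
    moreover have "V.span A \<subseteq> W" using V.span_is_subset[OF _ sub] AW by simp
    ultimately show ?thesis using WC by blast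
  qed
  ultimately show ?thesis using P Q by blast
qed

context group
begin

lemma representation_change_basis:
  assumes \<rho>: "is_representation G d \<rho>"
    and P: "P \<in> carrier_mat d d" and Q: "Q \<in> carrier_mat d d" and PQ: "P * Q = 1\<^sub>m d" "Q * P = 1\<^sub>m d"
  shows "is_representation G d (\<lambda>x. Q * \<rho> x * P)"
proof -
  note r = representationD[OF \<rho>]
  have "Q * (\<rho> x * \<rho> y) * P = (Q * \<rho> x * P) * (Q * \<rho> y * P)" if x: "x \<in> carrier G" and y: "y \<in> carrier G" for x y
  proof -
    note [simp] = r(2)[OF x] r(2)[OF y] P Q mult_carrier_mat[of _ d d _ d] left_mult_one_mat[of _ d d]
    have "(Q * \<rho> x * P) * (Q * \<rho> y * P) = Q * \<rho> x * (P * (Q * (\<rho> y * P)))"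
      by (simp add: assoc_mult_mat[of _ d d _ d _ d])
    also have "P * (Q * (\<rho> y * P)) = (P * Q) * (\<rho> y * P)"
      by (simp add: assoc_mult_mat[of _ d d _ d _ d])
    finally show ?thesis using PQ by (simp add: assoc_mult_mat[of _ d d _ d _ d])
  qed
  then show ?thesis using r P Q PQ by (auto simp: is_representation_iff)
qed

text \<open>A representation whose matrices are block upper triangular restricts to representations on
  the two diagonal blocks.\<close>

lemma block_triangular_representation:
  assumes R: "is_representation G d R" and k: "0 < k" "k < d"
    and zero: "\<forall>x\<in>carrier G. \<forall>i j. k \<le> i \<longrightarrow> i < d \<longrightarrow> j < k \<longrightarrow> R x $$ (i, j) = 0"
  defines "A \<equiv> \<lambda>x. mat k k (\<lambda>(i, j). R x $$ (i, j))"
    and "D \<equiv> \<lambda>x. mat (d - k) (d - k) (\<lambda>(i, j). R x $$ (i + k, j + k))"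
  shows "is_representation G k A" "is_representation G (d - k) D"
    "\<And>x. x \<in> carrier G \<Longrightarrow> mat_trace (R x) = mat_trace (A x) + mat_trace (D x)"
proof -
  note r = representationD[OF R]
  have mult: "R (x \<otimes> y) $$ (i, j) = (\<Sum>l = 0..<d. R x $$ (i, l) * R y $$ (l, j))"
    if "x \<in> carrier G" "y \<in> carrier G" "i < d" "j < d" for x y i j
    using r(2)[OF that(1)] r(2)[OF that(2)] that r(4)[OF that(1,2)] by (auto simp: scalar_prod_def)
  have split: "(\<Sum>l = 0..<d. f l) = (\<Sum>l = 0..<k. f l) + (\<Sum>l = 0..<d - k. f (l + k))" for f :: "nat \<Rightarrow> complex"
    using k sum.atLeastLessThan_concat[of 0 k d f] sum.shift_bounds_nat_ivl[of f 0 k "d - k"] by simp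
  have "A (x \<otimes> y) = A x * A y" if x: "x \<in> carrier G" and y: "y \<in> carrier G" for x y
  proof (rule eq_matI)
    fix i j assume "i < dim_row (A x * A y)" "j < dim_col (A x * A y)"
    then have ij: "i < k" "j < k" by (auto simp: A_def)
    have "A (x \<otimes> y) $$ (i, j) = (\<Sum>l = 0..<k. R x $$ (i, l) * R y $$ (l, j))"
      using ij k x y mult[of x y i j] zero by (simp add: A_def split)
    then show "A (x \<otimes> y) $$ (i, j) = (A x * A y) $$ (i, j)"
      using ij by (simp add: A_def scalar_prod_def)
  qed (auto simp: A_def)
  moreover have "A \<one> = 1\<^sub>m k" using k by (intro eq_matI) (auto simp: A_def r(3))
  ultimately show "is_representation G k A"
    using k by (auto simp: is_representation_iff) (simp add: A_def)
  have "D (x \<otimes> y) = D x * D y" if x: "x \<in> carrier G" and y: "y \<in> carrier G" for x y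
  proof (rule eq_matI)
    fix i j assume "i < dim_row (D x * D y)" "j < dim_col (D x * D y)"
    then have ij: "i < d - k" "j < d - k" by (auto simp: D_def)
    have "D (x \<otimes> y) $$ (i, j) = (\<Sum>l = 0..<d - k. R x $$ (i + k, l + k) * R y $$ (l + k, j + k))"
      using ij k x y mult[of x y "i + k" "j + k"] zero by (simp add: D_def split)
    then show "D (x \<otimes> y) $$ (i, j) = (D x * D y) $$ (i, j)"
      using ij by (simp add: D_def scalar_prod_def)
  qed (auto simp: D_def)
  moreover have "D \<one> = 1\<^sub>m (d - k)" using k by (intro eq_matI) (auto simp: D_def r(3))
  ultimately show "is_representation G (d - k) D"
    using k by (auto simp: is_representation_iff) (simp add: D_def)
  show "mat_trace (R x) = mat_trace (A x) + mat_trace (D x)" if "x \<in> carrier G" for x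
    using r(2)[OF that] split[of "\<lambda>i. R x $$ (i, i)"]
    by (simp add: mat_trace_def A_def D_def lessThan_atLeast0)
qed

text \<open>Induction on the degree. In a basis adapted to a proper invariant subspace the matrices become
  block triangular, and the trace is the sum of the traces of the two diagonal blocks, which are
  representations of smaller degree. The list records multiplicities.\<close>

theorem character_decomposition:
  assumes "is_representation G d \<rho>"
  shows "\<exists>cs. cs \<noteq> [] \<and> set cs \<subseteq> Irr G \<and>
    (\<forall>x\<in>carrier G. character_of G \<rho> x = (\<Sum>\<chi>\<leftarrow>cs. \<chi> x))"
  using assms
proof (induction d arbitrary: \<rho> rule: less_induct)
  case (less d)
  note r = representationD[OF less.prems]
  show ?case
  proof (cases "is_irreducible_representation G d \<rho>")
    case True
    then have "character_of G \<rho> \<in> Irr G" by (auto simp: Irr_def)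
    then show ?thesis by (intro exI[of _ "[character_of G \<rho>]"]) auto
  next
    case False
    then obtain W where W: "VectorSpace.subspace class_ring W (module_vec TYPE(complex) d)"
      and inv: "\<And>x w. x \<in> carrier G \<Longrightarrow> w \<in> W \<Longrightarrow> \<rho> x *\<^sub>v w \<in> W"
      and proper: "W \<noteq> {0\<^sub>v d}" "W \<noteq> carrier_vec d"
      using less.prems by (auto simp: is_irreducible_representation_def)
    obtain k P Q where kPQ: "k \<le> d" "P \<in> carrier_mat d d" "Q \<in> carrier_mat d d" "P * Q = 1\<^sub>m d" "Q * P = 1\<^sub>m d"
      "k = 0 \<longrightarrow> W = {0\<^sub>v d}" "k = d \<longrightarrow> W = carrier_vec d"
      and PW: "\<forall>j<k. col P j \<in> W"
      and QW: "\<forall>w\<in>W. \<forall>i. k \<le> i \<longrightarrow> i < d \<longrightarrow> (Q *\<^sub>v w) $ i = 0"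
      using subspace_adapted_basis[OF W] by (elim exE conjE) (rule that; assumption)
    have k: "0 < k" "k < d"
      using kPQ(1,6,7) proper by (meson gr0I, meson le_neq_implies_less)
    define R where "R x = Q * \<rho> x * P" for x
    have R: "is_representation G d R"
      unfolding R_def using kPQ by (intro representation_change_basis[OF less.prems])
    have zero: "\<forall>x\<in>carrier G. \<forall>i j. k \<le> i \<longrightarrow> i < d \<longrightarrow> j < k \<longrightarrow> R x $$ (i, j) = 0"
    proof (intro ballI allI impI)
      fix x i j assume x: "x \<in> carrier G" and ij: "k \<le> i" "i < d" "j < k"
      have jd: "j < d" using ij by simp
      have "R x = Q * (\<rho> x * P)"
        unfolding R_def using kPQ r(2)[OF x] by (intro assoc_mult_mat) auto
      then have "col (R x) j = Q *\<^sub>v (\<rho> x *\<^sub>v col P j)"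
        using col_mult2[OF kPQ(3) mult_carrier_mat[OF r(2)[OF x] kPQ(2)] jd]
          col_mult2[OF r(2)[OF x] kPQ(2) jd] by (simp only:)
      then have "R x $$ (i, j) = (Q *\<^sub>v (\<rho> x *\<^sub>v col P j)) $ i"
        using representationD(2)[OF R x] ij jd by (metis carrier_matD index_col)
      then show "R x $$ (i, j) = 0" using QW inv[OF x] PW ij by simp
    qed
    let ?A = "\<lambda>x. mat k k (\<lambda>(i, j). R x $$ (i, j))"
    let ?D = "\<lambda>x. mat (d - k) (d - k) (\<lambda>(i, j). R x $$ (i + k, j + k))"
    note block = block_triangular_representation[OF R k zero]
    obtain as where as: "as \<noteq> []" "set as \<subseteq> Irr G"
      "\<forall>x\<in>carrier G. character_of G ?A x = (\<Sum>\<chi>\<leftarrow>as. \<chi> x)"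
      using less.IH[OF k(2) block(1)] by blast
    obtain ds where ds: "set ds \<subseteq> Irr G"
      "\<forall>x\<in>carrier G. character_of G ?D x = (\<Sum>\<chi>\<leftarrow>ds. \<chi> x)"
      using less.IH[OF _ block(2)] k by auto
    have "character_of G \<rho> x = (\<Sum>\<chi>\<leftarrow>as @ ds. \<chi> x)" if x: "x \<in> carrier G" for x
    proof -
      have "mat_trace (\<rho> x) = mat_trace (R x)"
        unfolding R_def using kPQ r(2)[OF x] by (intro mat_trace_conjugate[symmetric]) auto
      then show ?thesis using block(3)[OF x] as(3) ds(2) x by (simp add: character_of_def)
    qed
    then show ?thesis using as ds by (intro exI[of _ "as @ ds"]) auto
  qed
qed

end

section \<open>The regular character\<close>

lemma sum_list_eq_sum_count:
  fixes f :: "'c \<Rightarrow> complex"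
  assumes "finite S" "set cs \<subseteq> S"
  shows "(\<Sum>c\<leftarrow>cs. f c) = (\<Sum>c\<in>S. of_nat (count_list cs c) * f c)"
  using assms(2)
proof (induction cs)
  case (Cons a cs)
  have "(\<Sum>c\<in>S. of_nat (count_list (a # cs) c) * f c)
      = (\<Sum>c\<in>S. (if c = a then f c else 0) + of_nat (count_list cs c) * f c)"
    by (intro sum.cong) (auto simp: distrib_right)
  then show ?case using Cons assms(1) by (simp add: sum.distrib)
qed simp

context fin_group
begin

lemma Irr_orthogonality:
  assumes "\<chi> \<in> Irr G" "\<psi> \<in> Irr G"
  shows "(\<Sum>x\<in>carrier G. \<chi> x * \<psi> (inv x)) = (if \<chi> = \<psi> then of_nat (Coset.order G) else 0)"
  using assms irreducible_orthogonality unfolding Irr_def by fastforce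

lemma sum_list_Irr_orthogonality:
  assumes "set cs \<subseteq> Irr G" "\<psi> \<in> Irr G"
  shows "(\<Sum>x\<in>carrier G. (\<Sum>\<chi>\<leftarrow>cs. \<chi> x) * \<psi> (inv x)) = of_nat (Coset.order G) * of_nat (count_list cs \<psi>)"
  using assms
  by (induction cs) (auto simp: Irr_orthogonality distrib_right sum.distrib distrib_left)

text \<open>The regular representation: left multiplication as permutation matrices, with respect to an
  enumeration \<open>e\<close> of the group.\<close>

theorem regular_character:
  "\<exists>\<rho>. is_representation G (Coset.order G) \<rho> \<and>
     (\<forall>x\<in>carrier G. character_of G \<rho> x = (if x = \<one> then of_nat (Coset.order G) else 0))"
proof -
  define N where "N = Coset.order G"
  obtain e where "bij_betw e {0..<N} (carrier G)"
    using ex_bij_betw_nat_finite[OF fin] by (auto simp: N_def Coset.order_def)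
  then have e: "bij_betw e {..<N} (carrier G)" by (simp add: lessThan_atLeast0)
  define \<rho> where "\<rho> x = mat N N (\<lambda>(i, j). if e i = x \<otimes> e j then 1 else (0::complex))" for x
  have ec: "e i \<in> carrier G" if "i < N" for i using bij_betwE[OF e] that by blast
  have ei: "e i = e j \<longleftrightarrow> i = j" if "i < N" "j < N" for i j
    using e that by (auto simp: bij_betw_def inj_on_def)
  have "\<rho> (x \<otimes> y) = \<rho> x * \<rho> y" if xy: "x \<in> carrier G" "y \<in> carrier G" for x y
  proof (rule eq_matI)
    fix i j assume "i < dim_row (\<rho> x * \<rho> y)" "j < dim_col (\<rho> x * \<rho> y)"
    then have ij: "i < N" "j < N" by (auto simp: \<rho>_def)
    obtain m where m: "m < N" "e m = y \<otimes> e j"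
      using e xy(2) ec[OF ij(2)] by (metis bij_betw_imp_surj_on imageE lessThan_iff m_closed)
    have "(\<rho> x * \<rho> y) $$ (i, j)
        = (\<Sum>l = 0..<N. (if e i = x \<otimes> e l then 1 else 0) * (if e l = y \<otimes> e j then 1 else 0))"
      using ij by (simp add: \<rho>_def scalar_prod_def)
    also have "\<dots> = (\<Sum>l = 0..<N. if l = m then (if e i = x \<otimes> e l then 1 else 0) else 0)"
      by (intro sum.cong) (auto simp: m(2)[symmetric] ei m(1))
    also have "\<dots> = \<rho> (x \<otimes> y) $$ (i, j)"
      using m ij xy ec by (simp add: \<rho>_def m_assoc)
    finally show "\<rho> (x \<otimes> y) $$ (i, j) = (\<rho> x * \<rho> y) $$ (i, j)" by simp
  qed (auto simp: \<rho>_def)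
  moreover have "\<rho> \<one> = 1\<^sub>m N" using ec ei by (intro eq_matI) (auto simp: \<rho>_def)
  ultimately have "is_representation G N \<rho>"
    using order_pos by (auto simp: is_representation_iff N_def[symmetric]) (simp add: \<rho>_def)
  moreover have "character_of G \<rho> x = (if x = \<one> then of_nat N else 0)" if x: "x \<in> carrier G" for x
  proof -
    have "e i = x \<otimes> e i \<longleftrightarrow> x = \<one>" if "i < N" for i
      using ec[OF that] x by simp
    then show ?thesis using x by (simp add: character_of_def mat_trace_def \<rho>_def)
  qed
  ultimately show ?thesis unfolding N_def by blast
qed

lemma Irr_one_pos: "\<chi> \<in> Irr G \<Longrightarrow> \<exists>d>0. \<chi> \<one> = of_nat d"
  unfolding Irr_def using character_of_one irreducible_representationD(1) representationD(1) by blast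

text \<open>By orthogonality an irreducible character \<open>\<chi>\<close> occurs in the regular character exactly \<open>\<chi> 1\<close> times.
  So \<open>Irr G\<close> is the set of constituents of the regular character, which makes it finite, and the
  indicator function of the identity is a combination of irreducible characters.\<close>

lemma regular_character_decomposition:
  shows finite_Irr: "finite (Irr G)" and Irr_nonempty: "Irr G \<noteq> {}"
    and sum_Irr_degree: "\<And>x. x \<in> carrier G \<Longrightarrow>
      (\<Sum>\<chi>\<in>Irr G. \<chi> \<one> * \<chi> x) = (if x = \<one> then of_nat (Coset.order G) else 0)"
proof -
  obtain \<rho> where \<rho>: "is_representation G (Coset.order G) \<rho>"
    "\<And>x. x \<in> carrier G \<Longrightarrow> character_of G \<rho> x = (if x = \<one> then of_nat (Coset.order G) else 0)"
    using regular_character by blast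
  obtain cs where cs: "cs \<noteq> []" "set cs \<subseteq> Irr G"
    "\<And>x. x \<in> carrier G \<Longrightarrow> character_of G \<rho> x = (\<Sum>\<chi>\<leftarrow>cs. \<chi> x)"
    using character_decomposition[OF \<rho>(1)] by blast
  have count: "of_nat (count_list cs \<psi>) = \<psi> \<one>" if \<psi>: "\<psi> \<in> Irr G" for \<psi>
  proof -
    have "of_nat (Coset.order G) * of_nat (count_list cs \<psi>) = (\<Sum>x\<in>carrier G. (\<Sum>\<chi>\<leftarrow>cs. \<chi> x) * \<psi> (inv x))"
      by (rule sum_list_Irr_orthogonality[OF cs(2) \<psi>, symmetric])
    also have "\<dots> = (\<Sum>x\<in>carrier G. if x = \<one> then of_nat (Coset.order G) * \<psi> \<one> else 0)"
      using \<rho>(2) cs(3) by (intro sum.cong) auto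
    also have "\<dots> = of_nat (Coset.order G) * \<psi> \<one>" using fin by simp
    finally show ?thesis using order_pos by simp
  qed
  have Irr: "Irr G = set cs"
  proof
    show "Irr G \<subseteq> set cs"
      using count Irr_one_pos count_list_0_iff by (metis less_numeral_extra(3) of_nat_0_eq_iff of_nat_eq_iff subsetI)
  qed (rule cs(2))
  then show "finite (Irr G)" "Irr G \<noteq> {}" using cs(1) by auto
  fix x assume x: "x \<in> carrier G"
  have "(\<Sum>\<chi>\<leftarrow>cs. \<chi> x) = (\<Sum>\<chi>\<in>set cs. of_nat (count_list cs \<chi>) * \<chi> x)"
    by (rule sum_list_eq_sum_count) auto
  then show "(\<Sum>\<chi>\<in>Irr G. \<chi> \<one> * \<chi> x) = (if x = \<one> then of_nat (Coset.order G) else 0)"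
    using \<rho>(2)[OF x] cs(3)[OF x] count by (simp add: Irr)
qed

end

section \<open>Algebraic integers\<close>

text \<open>Integrality from a finitely generated module: if multiplication by \<open>\<alpha>\<close> maps a finite nonzero
  family into its integer span, then \<open>\<alpha>\<close> is an eigenvalue of an integer matrix.\<close>

lemma algebraic_int_of_integer_span:
  fixes \<alpha> :: complex and s :: "'i \<Rightarrow> complex"
  assumes fin: "finite I" and nz: "i0 \<in> I" "s i0 \<noteq> 0"
    and span: "\<And>i. i \<in> I \<Longrightarrow> \<exists>a::'i \<Rightarrow> int. \<alpha> * s i = (\<Sum>j\<in>I. of_int (a j) * s j)"
  shows "algebraic_int \<alpha>"
proof -
  have "\<forall>i. \<exists>a::'i \<Rightarrow> int. i \<in> I \<longrightarrow> \<alpha> * s i = (\<Sum>j\<in>I. of_int (a j) * s j)"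
    using span by blast
  then obtain a :: "'i \<Rightarrow> 'i \<Rightarrow> int"
    where a: "\<And>i. i \<in> I \<Longrightarrow> \<alpha> * s i = (\<Sum>j\<in>I. of_int (a i j) * s j)" by metis
  define n where "n = card I"
  obtain e where e: "bij_betw e {0..<n} I" using ex_bij_betw_nat_finite[OF fin] by (auto simp: n_def)
  define A where "A = mat n n (\<lambda>(i, j). a (e i) (e j))"
  define C where "C = map_mat (of_int :: int \<Rightarrow> complex) A"
  define v where "v = vec n (\<lambda>i. s (e i))"
  have A: "A \<in> carrier_mat n n" and C: "C \<in> carrier_mat n n" and v: "v \<in> carrier_vec n"
    by (auto simp: A_def C_def v_def)
  have "C *\<^sub>v v = \<alpha> \<cdot>\<^sub>v v"
  proof (rule eq_vecI)
    fix i assume "i < dim_vec (\<alpha> \<cdot>\<^sub>v v)"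
    then have i: "i < n" by (simp add: v_def)
    have "(C *\<^sub>v v) $ i = (\<Sum>j = 0..<n. of_int (a (e i) (e j)) * s (e j))"
      using i by (simp add: C_def A_def v_def scalar_prod_def)
    also have "\<dots> = (\<Sum>j\<in>I. of_int (a (e i) j) * s j)"
      by (rule sum.reindex_bij_betw[OF e])
    also have "\<dots> = (\<alpha> \<cdot>\<^sub>v v) $ i" using a[of "e i"] bij_betwE[OF e] i by (simp add: v_def)
    finally show "(C *\<^sub>v v) $ i = (\<alpha> \<cdot>\<^sub>v v) $ i" .
  qed (use C in \<open>simp add: v_def\<close>)
  moreover have "v \<noteq> 0\<^sub>v n"
  proof
    assume "v = 0\<^sub>v n"
    moreover obtain k where "k < n" "e k = i0"
      using nz(1) bij_betw_imp_surj_on[OF e] by (metis atLeastLessThan_iff imageE)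
    ultimately show False using nz(2) by (metis index_vec index_zero_vec(1) v_def)
  qed
  ultimately have "eigenvalue C \<alpha>"
    using v C by (auto simp: eigenvalue_def eigenvector_def)
  then have "poly (char_poly C) \<alpha> = 0" using eigenvalue_root_char_poly[OF C] by simp
  also have "char_poly C = map_poly of_int (char_poly A)"
    unfolding C_def by (rule of_int_hom.char_poly_hom[OF A])
  finally show ?thesis
    using degree_monic_char_poly[OF A] by (auto simp: algebraic_int_altdef_ipoly)
qed

text \<open>Conversely, the powers of an algebraic integer below the degree of a monic integer equation span
  a module of the kind required above. Products of such powers then serve for sums and products.\<close>

lemma algebraic_int_powers_span:
  fixes \<alpha> :: complex
  assumes "algebraic_int \<alpha>"
  shows "\<exists>m>0. \<forall>i<m. \<exists>a::nat \<Rightarrow> int. \<alpha> * \<alpha> ^ i = (\<Sum>j<m. of_int (a j) * \<alpha> ^ j)"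
proof -
  obtain p :: "int poly" where p: "poly (map_poly of_int p) \<alpha> = 0" "lead_coeff p = 1"
    using assms by (auto simp: algebraic_int_altdef_ipoly)
  define m where "m = degree p"
  have m: "m > 0"
  proof (rule ccontr)
    assume "\<not> m > 0"
    then have "p = 1" using p(2) unfolding m_def by (metis gr0I lead_coeff_1 degree_0_id one_pCons)
    then show False using p(1) by simp
  qed
  have "0 = (\<Sum>j\<le>m. of_int (Polynomial.coeff p j) * \<alpha> ^ j)"
    using p(1) by (simp add: poly_altdef degree_map_poly coeff_map_poly m_def)
  also have "\<dots> = (\<Sum>j<m. of_int (Polynomial.coeff p j) * \<alpha> ^ j) + \<alpha> ^ m"
    using p(2) by (simp add: lessThan_Suc_atMost[symmetric] m_def)
  finally have top: "\<alpha> ^ m = (\<Sum>j<m. of_int (- Polynomial.coeff p j) * \<alpha> ^ j)"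
    by (simp add: sum_negf eq_neg_iff_add_eq_0 add.commute)
  have "\<exists>a::nat \<Rightarrow> int. \<alpha> * \<alpha> ^ i = (\<Sum>j<m. of_int (a j) * \<alpha> ^ j)" if "i < m" for i
  proof (cases "Suc i = m")
    case True
    then show ?thesis using top by (metis power_Suc)
  next
    case False
    then have "Suc i < m" using that by simp
    then have "\<alpha> * \<alpha> ^ i = (\<Sum>j<m. of_int (if j = Suc i then 1 else 0) * \<alpha> ^ j)"
      by (simp add: if_distrib[of of_int] if_distrib[of "\<lambda>c. c * _"] cong: if_cong)
    then show ?thesis by (intro exI[of _ "\<lambda>j. if j = Suc i then 1 else 0"])
  qed
  then show ?thesis using m by blast
qed

lemma algebraic_int_add_mult:
  fixes \<alpha> \<beta> :: complex
  assumes "algebraic_int \<alpha>" "algebraic_int \<beta>"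
  shows algebraic_int_add: "algebraic_int (\<alpha> + \<beta>)" and algebraic_int_mult: "algebraic_int (\<alpha> * \<beta>)"
proof -
  obtain m where m: "m > 0"
    "\<And>i. i < m \<Longrightarrow> \<exists>a::nat \<Rightarrow> int. \<alpha> * \<alpha> ^ i = (\<Sum>k<m. of_int (a k) * \<alpha> ^ k)"
    using algebraic_int_powers_span[OF assms(1)] by blast
  obtain n where n: "n > 0"
    "\<And>j. j < n \<Longrightarrow> \<exists>b::nat \<Rightarrow> int. \<beta> * \<beta> ^ j = (\<Sum>l<n. of_int (b l) * \<beta> ^ l)"
    using algebraic_int_powers_span[OF assms(2)] by blast
  let ?I = "{..<m} \<times> {..<n}" and ?s = "\<lambda>(i, j). \<alpha> ^ i * \<beta> ^ j"
  have fin: "finite ?I" and nz: "(0, 0) \<in> ?I" "?s (0, 0) \<noteq> 0" using m(1) n(1) by auto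
  show "algebraic_int (\<alpha> + \<beta>)"
  proof (rule algebraic_int_of_integer_span[of ?I "(0, 0)" ?s, OF fin nz])
    fix ij assume "ij \<in> ?I"
    then obtain i j where ij: "ij = (i, j)" "i < m" "j < n" by auto
    obtain a :: "nat \<Rightarrow> int" where a: "\<alpha> * \<alpha> ^ i = (\<Sum>k<m. of_int (a k) * \<alpha> ^ k)"
      using m(2)[OF ij(2)] by blast
    obtain b :: "nat \<Rightarrow> int" where b: "\<beta> * \<beta> ^ j = (\<Sum>l<n. of_int (b l) * \<beta> ^ l)"
      using n(2)[OF ij(3)] by blast
    let ?c = "\<lambda>(k, l). (if l = j then a k else 0) + (if k = i then b l else 0)"
    have "(\<Sum>kl\<in>?I. of_int (?c kl) * ?s kl)
        = (\<Sum>k<m. \<Sum>l<n. (if l = j then of_int (a k) * (\<alpha> ^ k * \<beta> ^ l) else 0)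
            + (if k = i then of_int (b l) * (\<alpha> ^ k * \<beta> ^ l) else 0))"
      unfolding sum.cartesian_product by (intro sum.cong) (auto simp: distrib_right)
    also have "\<dots> = (\<Sum>k<m. of_int (a k) * (\<alpha> ^ k * \<beta> ^ j))
        + (\<Sum>l<n. \<Sum>k<m. if k = i then of_int (b l) * (\<alpha> ^ k * \<beta> ^ l) else 0)"
      using ij by (simp add: sum.distrib sum.swap[of _ "{..<n}" "{..<m}"])
    also have "\<dots> = (\<Sum>k<m. of_int (a k) * \<alpha> ^ k) * \<beta> ^ j + \<alpha> ^ i * (\<Sum>l<n. of_int (b l) * \<beta> ^ l)"
      using ij by (simp add: sum_distrib_left sum_distrib_right mult_ac)
    also have "\<dots> = (\<alpha> + \<beta>) * ?s ij"
      unfolding a[symmetric] b[symmetric] ij(1) by (simp add: algebra_simps)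
    finally show "\<exists>c::nat \<times> nat \<Rightarrow> int. (\<alpha> + \<beta>) * ?s ij = (\<Sum>kl\<in>?I. of_int (c kl) * ?s kl)"
      by (intro exI[of _ ?c]) (rule sym)
  qed
  show "algebraic_int (\<alpha> * \<beta>)"
  proof (rule algebraic_int_of_integer_span[of ?I "(0, 0)" ?s, OF fin nz])
    fix ij assume "ij \<in> ?I"
    then obtain i j where ij: "ij = (i, j)" "i < m" "j < n" by auto
    obtain a :: "nat \<Rightarrow> int" where a: "\<alpha> * \<alpha> ^ i = (\<Sum>k<m. of_int (a k) * \<alpha> ^ k)"
      using m(2)[OF ij(2)] by blast
    obtain b :: "nat \<Rightarrow> int" where b: "\<beta> * \<beta> ^ j = (\<Sum>l<n. of_int (b l) * \<beta> ^ l)"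
      using n(2)[OF ij(3)] by blast
    let ?c = "\<lambda>(k, l). a k * b l"
    have "(\<Sum>kl\<in>?I. of_int (?c kl) * ?s kl)
        = (\<Sum>k<m. of_int (a k) * \<alpha> ^ k) * (\<Sum>l<n. of_int (b l) * \<beta> ^ l)"
      by (auto simp: sum_product sum.cartesian_product mult_ac intro!: sum.cong)
    also have "\<dots> = \<alpha> * \<beta> * ?s ij"
      unfolding a[symmetric] b[symmetric] ij(1) by (simp add: mult_ac)
    finally show "\<exists>c::nat \<times> nat \<Rightarrow> int. \<alpha> * \<beta> * ?s ij = (\<Sum>kl\<in>?I. of_int (c kl) * ?s kl)"
      by (intro exI[of _ ?c]) (rule sym)
  qed
qed

lemma algebraic_int_sum:
  fixes f :: "'i \<Rightarrow> complex"
  assumes "\<And>i. i \<in> S \<Longrightarrow> algebraic_int (f i)"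
  shows "algebraic_int (\<Sum>i\<in>S. f i)"
  using assms by (induction S rule: infinite_finite_induct) (auto intro: algebraic_int_add)

lemma algebraic_int_root_of_unity:
  fixes \<zeta> :: complex
  assumes "\<zeta> ^ N = 1" "N > 0"
  shows "algebraic_int \<zeta>"
  using assms
  by (intro algebraic_int_root[of 1 "Polynomial.monom 1 N" \<zeta>])
     (auto simp: poly_monom degree_monom_eq int_imp_algebraic_int)

section \<open>Character values are sums of roots of unity\<close>

lemma upper_triangular_pow:
  fixes B :: "complex mat"
  assumes B: "B \<in> carrier_mat d d" and ut: "upper_triangular B"
  shows "upper_triangular (B ^\<^sub>m k) \<and> (\<forall>i<d. (B ^\<^sub>m k) $$ (i, i) = B $$ (i, i) ^ k)"
proof (induction k)
  case 0
  show ?case using B by auto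
next
  case (Suc k)
  let ?C = "B ^\<^sub>m k"
  have C: "?C \<in> carrier_mat d d" using B by simp
  have C0: "?C $$ (i, l) = 0" if "l < i" "i < d" for i l
    using Suc C that by (auto dest: upper_triangularD)
  have B0: "B $$ (i, l) = 0" if "l < i" "i < d" for i l
    using ut B that by (auto dest: upper_triangularD)
  have mult: "(?C * B) $$ (i, j) = (\<Sum>l = 0..<d. ?C $$ (i, l) * B $$ (l, j))" if "i < d" "j < d" for i j
    using B C that by (auto simp: scalar_prod_def)
  have "(?C * B) $$ (i, j) = 0" if "j < i" "i < d" for i j
  proof -
    have "?C $$ (i, l) * B $$ (l, j) = 0" if "l < d" for l
      using C0[of l i] B0[of j l] \<open>j < i\<close> \<open>i < d\<close> that by (cases "l < i") auto
    then show ?thesis using that by (auto simp: mult intro!: sum.neutral)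
  qed
  moreover have "(?C * B) $$ (i, i) = B $$ (i, i) ^ Suc k" if i: "i < d" for i
  proof -
    have "?C $$ (i, l) * B $$ (l, i) = (if l = i then B $$ (i, i) ^ Suc k else 0)" if "l < d" for l
      using C0[of l i] B0[of i l] i that Suc.IH by (cases l i rule: linorder_cases) auto
    then show ?thesis using i by (simp add: mult)
  qed
  ultimately show ?case using B C by (auto intro!: upper_triangularI)
qed

text \<open>A triangularisation makes all powers of \<open>A\<close> upper triangular at the same time, with the
  powers of the eigenvalues on the diagonal.\<close>

lemma finite_order_mat_trace_pow:
  assumes A: "A \<in> carrier_mat d d" and AN: "A ^\<^sub>m N = 1\<^sub>m d"
  shows "\<exists>e. (\<forall>i<d. e i ^ N = (1::complex)) \<and> (\<forall>k. mat_trace (A ^\<^sub>m k) = (\<Sum>i<d. e i ^ k))"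
proof -
  obtain as where "char_poly A = (\<Prod>a\<leftarrow>as. [:- a, 1:])" using char_poly_factorized[OF A] by blast
  then obtain B where B: "B \<in> carrier_mat d d" "upper_triangular B" "similar_mat A B"
    using schur_decomposition_exists[OF A] by blast
  then obtain P Q where wit: "similar_mat_wit A B P Q" by (auto simp: similar_mat_def)
  note w = similar_mat_witD2[OF A wit]
  note pow = similar_mat_wit_pow_id[OF wit] and tri = upper_triangular_pow[OF B(1,2)]
  have "B $$ (i, i) ^ N = 1" if i: "i < d" for i
  proof -
    have "B ^\<^sub>m N = Q * A ^\<^sub>m N * P"
      using similar_mat_wit_pow_id[OF similar_mat_wit_sym[OF wit]] .
    also have "\<dots> = 1\<^sub>m d" using w(2,6,7) by (simp add: AN)
    finally show ?thesis using tri[of N] i by simp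
  qed
  moreover have "mat_trace (A ^\<^sub>m k) = (\<Sum>i<d. B $$ (i, i) ^ k)" for k
  proof -
    have "mat_trace (A ^\<^sub>m k) = mat_trace (B ^\<^sub>m k)"
      unfolding pow using w by (intro mat_trace_conjugate[of _ d _ d]) auto
    then show ?thesis using tri[of k] B(1) by (simp add: mat_trace_def)
  qed
  ultimately show ?thesis by (intro exI[of _ "\<lambda>i. B $$ (i, i)"]) simp
qed

context fin_group
begin

lemma character_pow_roots_of_unity:
  assumes \<rho>: "is_representation G d \<rho>" and x: "x \<in> carrier G"
  shows "\<exists>e. (\<forall>i<d. e i ^ Coset.order G = 1) \<and>
    (\<forall>k. character_of G \<rho> (x [^] (k::nat)) = (\<Sum>i<d. e i ^ k))"
proof -
  note r = representationD[OF \<rho>]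
  have "\<rho> x ^\<^sub>m Coset.order G = 1\<^sub>m d"
    using representation_pow[OF \<rho> x, of "Coset.order G"] pow_order_eq_1[OF x] r(3) by simp
  then show ?thesis
    using finite_order_mat_trace_pow[OF r(2)[OF x]] x
    by (simp add: character_of_apply representation_pow[OF \<rho> x])
qed

lemma character_algebraic_int:
  assumes \<rho>: "is_representation G d \<rho>" and x: "x \<in> carrier G"
  shows "algebraic_int (character_of G \<rho> x)"
proof -
  obtain e where e: "\<And>i. i < d \<Longrightarrow> e i ^ Coset.order G = 1"
    "\<And>k::nat. character_of G \<rho> (x [^] k) = (\<Sum>i<d. e i ^ k)"
    using character_pow_roots_of_unity[OF \<rho> x] by blast
  have "character_of G \<rho> x = (\<Sum>i<d. e i)" using e(2)[of 1] x by simp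
  then show ?thesis
    using e(1) order_pos by (auto intro!: algebraic_int_sum algebraic_int_root_of_unity)
qed

text \<open>The inverse of \<open>x\<close> is a power of \<open>x\<close>, and the inverse of a root of unity is its conjugate.\<close>

lemma character_inv:
  assumes \<rho>: "is_representation G d \<rho>" and x: "x \<in> carrier G"
  shows "character_of G \<rho> (inv x) = cnj (character_of G \<rho> x)"
proof -
  obtain e where e: "\<And>i. i < d \<Longrightarrow> e i ^ Coset.order G = 1"
    "\<And>k::nat. character_of G \<rho> (x [^] k) = (\<Sum>i<d. e i ^ k)"
    using character_pow_roots_of_unity[OF \<rho> x] by blast
  obtain N where N: "Coset.order G = Suc N" using order_pos gr0_conv_Suc by blast
  have "x [^] N \<otimes> x = \<one>" using pow_order_eq_1[OF x] N by simp
  then have "inv x = x [^] N" using x by (intro inv_equality) auto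
  moreover have "e i ^ N = cnj (e i)" if "i < d" for i
  proof -
    have "norm (e i) ^ Suc N = 1" using e(1)[OF that] N by (metis norm_one norm_power)
    then have "norm (e i) = 1" using power_eq_imp_eq_base[of "norm (e i)" "Suc N" 1] by simp
    then have "cnj (e i) * e i = 1" by (simp add: complex_norm_square[symmetric] mult.commute)
    moreover have "e i ^ N * e i = 1" using e(1)[OF that] N by (simp add: mult.commute)
    ultimately show ?thesis by (metis mult_cancel_right mult_zero_right zero_neq_one)
  qed
  ultimately have "character_of G \<rho> (inv x) = (\<Sum>i<d. cnj (e i))" using e(2)[of N] by simp
  also have "\<dots> = cnj (character_of G \<rho> x)" using e(2)[of 1] x by simp
  finally show ?thesis .
qed

end

section \<open>Conjugation-invariant sums\<close>

context group
begin

lemma conj_conj: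
  "x \<in> carrier G \<Longrightarrow> y \<in> carrier G \<Longrightarrow> h \<in> carrier G \<Longrightarrow>
    y \<otimes> (x \<otimes> h \<otimes> inv x) \<otimes> inv y = (y \<otimes> x) \<otimes> h \<otimes> inv (y \<otimes> x)"
  by (simp add: inv_mult_group m_assoc)

lemma character_of_mult_commute:
  assumes \<rho>: "is_representation G d \<rho>" and xy: "x \<in> carrier G" "y \<in> carrier G"
  shows "character_of G \<rho> (x \<otimes> y) = character_of G \<rho> (y \<otimes> x)"
  using representationD[OF \<rho>] xy mat_trace_mult_commute[of "\<rho> x" d d "\<rho> y"]
  by (simp add: character_of_apply)

text \<open>A subset closed under conjugation by the whole group, such as a normal subgroup or a
  conjugacy class.\<close>

definition conj_invariant :: "'a set \<Rightarrow> bool" where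
  "conj_invariant S \<longleftrightarrow> S \<subseteq> carrier G \<and> (\<forall>x\<in>carrier G. \<forall>y\<in>S. x \<otimes> y \<otimes> inv x \<in> S)"

lemma bij_betw_conj:
  assumes S: "conj_invariant S" and x: "x \<in> carrier G"
  shows "bij_betw (\<lambda>y. x \<otimes> y \<otimes> inv x) S S"
proof (rule bij_betw_byWitness[where f' = "\<lambda>y. inv x \<otimes> y \<otimes> inv (inv x)"])
  have "inv x \<otimes> (x \<otimes> y \<otimes> inv x) \<otimes> inv (inv x) = y" if "y \<in> S" for y
    using conj_conj[of x "inv x" y] S x that by (auto simp: conj_invariant_def)
  then show "\<forall>y\<in>S. inv x \<otimes> (x \<otimes> y \<otimes> inv x) \<otimes> inv (inv x) = y" by blast
  have "x \<otimes> (inv x \<otimes> y \<otimes> inv (inv x)) \<otimes> inv x = y" if "y \<in> S" for y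
    using conj_conj[of "inv x" x y] S x that by (auto simp: conj_invariant_def)
  then show "\<forall>y\<in>S. x \<otimes> (inv x \<otimes> y \<otimes> inv (inv x)) \<otimes> inv x = y" by blast
  show "(\<lambda>y. x \<otimes> y \<otimes> inv x) ` S \<subseteq> S" "(\<lambda>y. inv x \<otimes> y \<otimes> inv (inv x)) ` S \<subseteq> S"
    using S x inv_closed[OF x] unfolding conj_invariant_def by blast+
qed

text \<open>Schur's lemma for the group algebra: class functions act on irreducible representations as
  scalars.\<close>

lemma class_function_scalar:
  assumes \<rho>: "is_irreducible_representation G d \<rho>" and S: "conj_invariant S"
    and a: "\<And>x y. x \<in> carrier G \<Longrightarrow> y \<in> S \<Longrightarrow> a (x \<otimes> y \<otimes> inv x) = a y"
  shows "mat_sum d d (\<lambda>y. a y \<cdot>\<^sub>m \<rho> y) S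
    = ((\<Sum>y\<in>S. a y * character_of G \<rho> y) / of_nat d) \<cdot>\<^sub>m 1\<^sub>m d"
proof -
  let ?Z = "mat_sum d d (\<lambda>y. a y \<cdot>\<^sub>m \<rho> y) S"
  note r = representationD[OF irreducible_representationD(1)[OF \<rho>]]
  have SG: "y \<in> carrier G" if "y \<in> S" for y using S that by (auto simp: conj_invariant_def)
  have comm: "\<rho> x * ?Z = ?Z * \<rho> x" if x: "x \<in> carrier G" for x
  proof -
    have "?Z = mat_sum d d (\<lambda>y. a (x \<otimes> y \<otimes> inv x) \<cdot>\<^sub>m \<rho> (x \<otimes> y \<otimes> inv x)) S"
      by (rule mat_sum_reindex_bij[OF bij_betw_conj[OF S x], symmetric])
    also have "\<dots> * \<rho> x = mat_sum d d (\<lambda>y. a (x \<otimes> y \<otimes> inv x) \<cdot>\<^sub>m \<rho> (x \<otimes> y \<otimes> inv x) * \<rho> x) S"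
      using r(2) x SG by (intro mat_sum_mult_right) auto
    also have "\<dots> = mat_sum d d (\<lambda>y. \<rho> x * (a y \<cdot>\<^sub>m \<rho> y)) S"
    proof (rule mat_sum_cong)
      fix y assume y: "y \<in> S"
      note yG = SG[OF y]
      have "a (x \<otimes> y \<otimes> inv x) \<cdot>\<^sub>m \<rho> (x \<otimes> y \<otimes> inv x) * \<rho> x = a y \<cdot>\<^sub>m (\<rho> (x \<otimes> y \<otimes> inv x) * \<rho> x)"
        unfolding a[OF x y] using r(2)[OF x] r(2)[of "x \<otimes> y \<otimes> inv x"] x yG
        by (intro mult_smult_assoc_mat[of _ d d _ d]) auto
      also have "\<rho> (x \<otimes> y \<otimes> inv x) * \<rho> x = \<rho> x * \<rho> y"
        using r(4)[of "x \<otimes> y \<otimes> inv x" x] r(4)[OF x yG] x yG by (simp add: m_assoc)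
      also have "a y \<cdot>\<^sub>m (\<rho> x * \<rho> y) = \<rho> x * (a y \<cdot>\<^sub>m \<rho> y)"
        using r(2)[OF x] r(2)[OF yG] by (rule mult_smult_distrib[symmetric])
      finally show "a (x \<otimes> y \<otimes> inv x) \<cdot>\<^sub>m \<rho> (x \<otimes> y \<otimes> inv x) * \<rho> x = \<rho> x * (a y \<cdot>\<^sub>m \<rho> y)" .
    qed simp
    also have "\<dots> = \<rho> x * ?Z"
      using r(2) x SG by (intro mat_sum_mult_left[symmetric]) auto
    finally show ?thesis by simp
  qed
  have tr: "mat_trace ?Z = (\<Sum>y\<in>S. a y * character_of G \<rho> y)"
  proof -
    have "mat_trace ?Z = (\<Sum>y\<in>S. mat_trace (a y \<cdot>\<^sub>m \<rho> y))"
      using r(2) SG by (intro mat_trace_mat_sum) auto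
    also have "\<dots> = (\<Sum>y\<in>S. a y * character_of G \<rho> y)"
      using r(2) SG by (intro sum.cong) (auto simp: character_of_apply mat_trace_smult[of _ d])
    finally show ?thesis .
  qed
  show ?thesis by (rule Schur_scalar[OF \<rho> mat_sum_carrier comm, unfolded tr])
qed

lemma class_function_character_sum:
  assumes \<rho>: "is_irreducible_representation G d \<rho>" and S: "conj_invariant S"
    and a: "\<And>x y. x \<in> carrier G \<Longrightarrow> y \<in> S \<Longrightarrow> a (x \<otimes> y \<otimes> inv x) = a y"
    and g: "g \<in> carrier G"
  shows "(\<Sum>y\<in>S. a y * character_of G \<rho> (y \<otimes> g))
    = (\<Sum>y\<in>S. a y * character_of G \<rho> y) / of_nat d * character_of G \<rho> g"
proof -
  note r = representationD[OF irreducible_representationD(1)[OF \<rho>]]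
  have SG: "y \<in> carrier G" if "y \<in> S" for y using S that by (auto simp: conj_invariant_def)
  have "(\<Sum>y\<in>S. a y * character_of G \<rho> (y \<otimes> g)) = (\<Sum>y\<in>S. mat_trace (a y \<cdot>\<^sub>m \<rho> y * \<rho> g))"
  proof (rule sum.cong)
    fix y assume y: "y \<in> S"
    have "a y \<cdot>\<^sub>m \<rho> y * \<rho> g = a y \<cdot>\<^sub>m (\<rho> y * \<rho> g)"
      using r(2)[OF g] r(2)[OF SG[OF y]] by (intro mult_smult_assoc_mat)
    moreover have "\<rho> y * \<rho> g \<in> carrier_mat d d"
      using r(2)[OF g] r(2)[OF SG[OF y]] by (rule mult_carrier_mat[rotated])
    ultimately show "a y * character_of G \<rho> (y \<otimes> g) = mat_trace (a y \<cdot>\<^sub>m \<rho> y * \<rho> g)"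
      using g SG[OF y] by (simp add: character_of_apply r(4) mat_trace_smult[of _ d])
  qed simp
  also have "\<dots> = mat_trace (mat_sum d d (\<lambda>y. a y \<cdot>\<^sub>m \<rho> y * \<rho> g) S)"
    using r(2) SG g by (intro mat_trace_mat_sum[symmetric] mult_carrier_mat[of _ d d]) auto
  also have "mat_sum d d (\<lambda>y. a y \<cdot>\<^sub>m \<rho> y * \<rho> g) S = mat_sum d d (\<lambda>y. a y \<cdot>\<^sub>m \<rho> y) S * \<rho> g"
    using r(2) SG g by (intro mat_sum_mult_right[symmetric]) auto
  also have "mat_sum d d (\<lambda>y. a y \<cdot>\<^sub>m \<rho> y) S
      = ((\<Sum>y\<in>S. a y * character_of G \<rho> y) / of_nat d) \<cdot>\<^sub>m 1\<^sub>m d"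
    by (rule class_function_scalar[OF \<rho> S a])
  also have "\<dots> * \<rho> g = ((\<Sum>y\<in>S. a y * character_of G \<rho> y) / of_nat d) \<cdot>\<^sub>m \<rho> g"
    using r(2)[OF g] by (simp add: mult_smult_assoc_mat[of _ d d _ d])
  finally show ?thesis using g r(2)[OF g] by (simp add: character_of_apply mat_trace_smult[of _ d])
qed

end

context fin_group
begin

text \<open>Multiplication by the central character value maps the family of all values of the character
  into its integer span, because \<open>class_function_character_sum\<close> with \<open>a = 1\<close> rewrites the product as a
  sum of character values.\<close>

lemma central_character_algebraic_int:
  assumes \<rho>: "is_irreducible_representation G d \<rho>" and S: "conj_invariant S"
  shows "algebraic_int ((\<Sum>y\<in>S. character_of G \<rho> y) / of_nat d)"
proof (rule algebraic_int_of_integer_span[of "carrier G" \<one> "character_of G \<rho>"])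
  note rep = irreducible_representationD(1)[OF \<rho>]
  have SG: "S \<subseteq> carrier G" using S by (auto simp: conj_invariant_def)
  show "character_of G \<rho> \<one> \<noteq> 0" using representationD(1)[OF rep] by (simp add: character_of_one[OF rep])
  fix g assume g: "g \<in> carrier G"
  have "(\<Sum>y\<in>S. character_of G \<rho> y) / of_nat d * character_of G \<rho> g = (\<Sum>y\<in>S. character_of G \<rho> (y \<otimes> g))"
    using class_function_character_sum[OF \<rho> S, of "\<lambda>_. 1" g] g by simp
  also have "\<dots> = (\<Sum>j | j \<in> carrier G \<and> j \<otimes> inv g \<in> S. character_of G \<rho> j)"
    using SG g by (intro sum.reindex_bij_witness[of _ "\<lambda>j. j \<otimes> inv g" "\<lambda>y. y \<otimes> g"])
      (auto simp: m_assoc subset_iff)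
  also have "\<dots> = (\<Sum>j\<in>carrier G. of_int (if j \<otimes> inv g \<in> S then 1 else 0) * character_of G \<rho> j)"
    using fin by (intro sum.mono_neutral_cong_left) auto
  finally show "\<exists>a. (\<Sum>y\<in>S. character_of G \<rho> y) / of_nat d * character_of G \<rho> g
      = (\<Sum>j\<in>carrier G. of_int (a j) * character_of G \<rho> j)"
    by (rule exI[of _ "\<lambda>j. if j \<otimes> inv g \<in> S then 1 else 0"])
qed (use fin in auto)

text \<open>Grouping the elements of \<open>S\<close> by conjugacy class writes the sum as a combination of central
  character values with character values as coefficients.\<close>

lemma norm_sum_algebraic_int:
  assumes \<rho>: "is_irreducible_representation G d \<rho>" and S: "conj_invariant S"
  shows "algebraic_int ((\<Sum>y\<in>S. character_of G \<rho> y * cnj (character_of G \<rho> y)) / of_nat d)"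
proof -
  note rep = irreducible_representationD(1)[OF \<rho>]
  define cls where "cls h = (\<lambda>x. x \<otimes> h \<otimes> inv x) ` carrier G" for h
  have SG: "S \<subseteq> carrier G" using S by (auto simp: conj_invariant_def)
  have cls_conj: "cls (x \<otimes> h \<otimes> inv x) = cls h" if "x \<in> carrier G" "h \<in> carrier G" for x h
  proof -
    have "cls (x \<otimes> h \<otimes> inv x) = (\<lambda>z. z \<otimes> h \<otimes> inv z) ` ((\<lambda>y. y \<otimes> x) ` carrier G)"
      using that by (auto simp: cls_def image_image conj_conj intro!: image_cong)
    also have "(\<lambda>y. y \<otimes> x) ` carrier G = carrier G"
    proof
      show "carrier G \<subseteq> (\<lambda>y. y \<otimes> x) ` carrier G"
      proof
        fix z assume "z \<in> carrier G"
        then show "z \<in> (\<lambda>y. y \<otimes> x) ` carrier G"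
          using that by (intro image_eqI[of _ _ "z \<otimes> inv x"]) (auto simp: m_assoc)
      qed
    qed (use that in auto)
    finally show ?thesis by (simp add: cls_def)
  qed
  have self: "h \<in> cls h" if "h \<in> carrier G" for h
    using that by (auto simp: cls_def intro!: image_eqI[of _ _ \<one>])
  let ?\<chi> = "character_of G \<rho>"
  have "algebraic_int ((\<Sum>h | h \<in> S \<and> cls h = cls k. ?\<chi> h * cnj (?\<chi> h)) / of_nat d)" if k: "k \<in> S" for k
  proof -
    let ?C = "{h \<in> S. cls h = cls k}"
    have kG: "k \<in> carrier G" using k SG by blast
    have C: "conj_invariant ?C"
      using S SG cls_conj by (auto simp: conj_invariant_def subset_iff)
    have "?\<chi> h = ?\<chi> k" if "h \<in> ?C" for h
    proof -
      have "h \<in> cls k" using self[of h] that SG by blast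
      then show ?thesis using character_of_conj[OF rep _ kG] by (auto simp: cls_def)
    qed
    then have eq: "(\<Sum>h\<in>?C. ?\<chi> h * cnj (?\<chi> h)) / of_nat d = (\<Sum>h\<in>?C. ?\<chi> h) / of_nat d * cnj (?\<chi> k)"
      by (simp add: sum_distrib_right)
    show ?thesis
      unfolding eq using central_character_algebraic_int[OF \<rho> C] character_algebraic_int[OF rep kG]
      by (intro algebraic_int_mult algebraic_int_cnj)
  qed
  moreover have "(\<Sum>y\<in>S. ?\<chi> y * cnj (?\<chi> y)) / of_nat d
      = (\<Sum>C\<in>cls ` S. (\<Sum>h | h \<in> S \<and> cls h = C. ?\<chi> h * cnj (?\<chi> h)) / of_nat d)"
    using sum.image_gen[OF finite_subset[OF SG fin], of "\<lambda>y. ?\<chi> y * cnj (?\<chi> y)" cls]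
    by (simp add: sum_divide_distrib)
  ultimately show ?thesis by (auto intro!: algebraic_int_sum)
qed

section \<open>The coefficients\<close>

text \<open>If \<open>cs\<close> lists the irreducible constituents with multiplicity, the norm is the number of pairs of
  positions in \<open>cs\<close> with equal entries.\<close>

lemma character_norm_nat:
  assumes \<rho>: "is_representation G d \<rho>"
  shows "\<exists>m>0. class_inner G (character_of G \<rho>) (character_of G \<rho>) = of_nat m"
proof -
  obtain cs where cs: "cs \<noteq> []" "set cs \<subseteq> Irr G"
    "\<And>x. x \<in> carrier G \<Longrightarrow> character_of G \<rho> x = (\<Sum>\<chi>\<leftarrow>cs. \<chi> x)"
    using character_decomposition[OF \<rho>] by blast
  have ip: "(\<Sum>x\<in>carrier G. character_of G \<rho> x * (\<Sum>\<psi>\<leftarrow>ds. \<psi> (inv x)))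
      = of_nat (Coset.order G) * of_nat (\<Sum>\<psi>\<leftarrow>ds. count_list cs \<psi>)" if "set ds \<subseteq> Irr G" for ds
    using that
  proof (induction ds)
    case (Cons \<psi> ds)
    have "(\<Sum>x\<in>carrier G. character_of G \<rho> x * \<psi> (inv x)) = of_nat (Coset.order G) * of_nat (count_list cs \<psi>)"
      using sum_list_Irr_orthogonality[OF cs(2), of \<psi>] Cons.prems cs(3) by simp
    then show ?case using Cons by (simp add: distrib_left sum.distrib)
  qed simp
  let ?m = "\<Sum>\<psi>\<leftarrow>cs. count_list cs \<psi>"
  have "class_inner G (character_of G \<rho>) (character_of G \<rho>)
      = (\<Sum>x\<in>carrier G. character_of G \<rho> x * (\<Sum>\<psi>\<leftarrow>cs. \<psi> (inv x))) / of_nat (Coset.order G)"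
    unfolding class_inner_def using cs(3) character_inv[OF \<rho>]
    by (intro arg_cong2[where f = "(/)"] sum.cong) (auto simp flip: cs(3))
  also have "\<dots> = of_nat ?m" using ip[OF cs(2)] order_pos by simp
  finally have "class_inner G (character_of G \<rho>) (character_of G \<rho>) = of_nat ?m" .
  moreover have "?m > 0" using cs(1) by (cases cs) auto
  ultimately show ?thesis by blast
qed

lemma restricted_character_norm_nat:
  assumes \<rho>: "is_representation G d \<rho>" and H: "subgroup H G"
  shows "\<exists>m>0. class_inner (G\<lparr>carrier := H\<rparr>) (restrict (character_of G \<rho>) H) (restrict (character_of G \<rho>) H)
    = of_nat m"
proof -
  interpret H: fin_group "G\<lparr>carrier := H\<rparr>"
    using subgroup.subgroup_is_group[OF H is_group] subgroup.subset[OF H] fin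
    by (auto simp: fin_group_def fin_group_axioms_def intro: finite_subset)
  have "is_representation (G\<lparr>carrier := H\<rparr>) d \<rho>"
    using representationD[OF \<rho>] subgroup.subset[OF H]
    by (auto simp: H.is_representation_iff subset_iff)
  moreover have "character_of (G\<lparr>carrier := H\<rparr>) \<rho> = restrict (character_of G \<rho>) H"
    using subgroup.subset[OF H] by (auto simp: character_of_def restrict_def fun_eq_iff subset_iff)
  ultimately show ?thesis using H.character_norm_nat by metis
qed

lemma restricted_norm_sum:
  assumes "subgroup H G"
  shows "of_nat (card H) * class_inner (G\<lparr>carrier := H\<rparr>) (restrict \<chi> H) (restrict \<chi> H)
    = (\<Sum>h\<in>H. \<chi> h * cnj (\<chi> h))"
proof -
  have "card H > 0"
    using subgroup.subset[OF assms] subgroup.one_closed[OF assms] fin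
    by (auto simp: card_gt_0_iff intro: finite_subset)
  then show ?thesis by (simp add: class_inner_def Coset.order_def)
qed

text \<open>The quotient is rational, and it is an algebraic integer, so it is an integer.\<close>

lemma coefficient_nat:
  assumes \<chi>: "\<chi> \<in> Irr G" and H: "subgroup H G" "conj_invariant H"
  shows "\<exists>m>0. of_nat (card H) * class_inner (G\<lparr>carrier := H\<rparr>) (restrict \<chi> H) (restrict \<chi> H) / \<chi> \<one>
    = of_nat m"
proof -
  obtain d \<rho> where \<rho>: "is_irreducible_representation G d \<rho>" and \<chi>\<rho>: "\<chi> = character_of G \<rho>"
    using \<chi> by (auto simp: Irr_def)
  note rep = irreducible_representationD(1)[OF \<rho>]
  have d: "\<chi> \<one> = of_nat d" "d > 0"
    using character_of_one[OF rep] representationD(1)[OF rep] by (auto simp: \<chi>\<rho>)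
  obtain k where k: "k > 0"
    "class_inner (G\<lparr>carrier := H\<rparr>) (restrict \<chi> H) (restrict \<chi> H) = of_nat k"
    using restricted_character_norm_nat[OF rep H(1)] by (auto simp: \<chi>\<rho>)
  define q where "q = of_nat (card H) * class_inner (G\<lparr>carrier := H\<rparr>) (restrict \<chi> H) (restrict \<chi> H) / \<chi> \<one>"
  have cH: "card H > 0"
    using subgroup.subset[OF H(1)] subgroup.one_closed[OF H(1)] fin
    by (auto simp: card_gt_0_iff intro: finite_subset)
  have "algebraic_int q"
    unfolding q_def restricted_norm_sum[OF H(1)] d(1) unfolding \<chi>\<rho>
    by (rule norm_sum_algebraic_int[OF \<rho> H(2)])
  moreover have qr: "q = of_real (real (card H * k) / real d)"
    by (simp add: q_def k(2) d(1))
  then have "q \<in> \<rat>" by simp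
  ultimately have "q \<in> \<int>" by (rule rational_algebraic_int_is_int)
  then obtain z where z: "q = of_int z" by (auto elim: Ints_cases)
  have "real_of_int z = real (card H * k) / real d"
    using z qr by (metis of_real_eq_iff of_real_of_int_eq)
  then have "real_of_int z > 0" using cH k(1) d(2) by simp
  then have "q = of_nat (nat z)" "nat z > 0" using z by auto
  then show ?thesis unfolding q_def by blast
qed

text \<open>The case \<open>H = G\<close> of the preceding lemma, where \<open>[\<chi>, \<chi>] = 1\<close>.\<close>

lemma degree_dvd_order:
  assumes \<chi>: "\<chi> \<in> Irr G"
  shows "\<exists>m>0. of_nat (Coset.order G) / \<chi> \<one> = of_nat m"
proof -
  obtain d \<rho> where \<rho>: "is_representation G d \<rho>" and \<chi>\<rho>: "\<chi> = character_of G \<rho>"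
    using \<chi> irreducible_representationD(1) by (auto simp: Irr_def)
  have "(\<Sum>h\<in>carrier G. \<chi> h * cnj (\<chi> h)) = of_nat (Coset.order G)"
    using Irr_orthogonality[OF \<chi> \<chi>] character_inv[OF \<rho>] by (simp add: \<chi>\<rho>)
  then show ?thesis
    using coefficient_nat[OF \<chi> subgroup_self] restricted_norm_sum[OF subgroup_self, of \<chi>]
    by (simp add: conj_invariant_def)
qed

end

section \<open>Sums of characters are characters\<close>

context group
begin

lemma is_character_add:
  assumes "is_character G \<phi>" "is_character G \<psi>"
  shows "is_character G (\<lambda>x\<in>carrier G. \<phi> x + \<psi> x)"
proof -
  obtain d \<rho> e \<sigma> where \<rho>: "is_representation G d \<rho>" "\<phi> = character_of G \<rho>"
    and \<sigma>: "is_representation G e \<sigma>" "\<psi> = character_of G \<sigma>"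
    using assms by (auto simp: is_character_def)
  note r = representationD[OF \<rho>(1)] and s = representationD[OF \<sigma>(1)]
  define \<tau> where "\<tau> x = four_block_mat (\<rho> x) (0\<^sub>m d e) (0\<^sub>m e d) (\<sigma> x)" for x
  have "\<tau> (x \<otimes> y) = \<tau> x * \<tau> y" if xy: "x \<in> carrier G" "y \<in> carrier G" for x y
  proof -
    note c = r(2)[OF xy(1)] r(2)[OF xy(2)] s(2)[OF xy(1)] s(2)[OF xy(2)]
    have "\<tau> x * \<tau> y = four_block_mat (\<rho> x * \<rho> y + 0\<^sub>m d e * 0\<^sub>m e d) (\<rho> x * 0\<^sub>m d e + 0\<^sub>m d e * \<sigma> y)
        (0\<^sub>m e d * \<rho> y + \<sigma> x * 0\<^sub>m e d) (0\<^sub>m e d * 0\<^sub>m d e + \<sigma> x * \<sigma> y)"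
      unfolding \<tau>_def using c by (intro mult_four_block_mat) auto
    then show ?thesis
      using c xy r(4) s(4) mult_carrier_mat[OF c(1,2)] mult_carrier_mat[OF c(3,4)] by (simp add: \<tau>_def)
  qed
  then have "is_representation G (d + e) \<tau>"
    using r s by (auto simp: is_representation_iff) (auto simp: \<tau>_def)
  moreover have "(\<lambda>x\<in>carrier G. \<phi> x + \<psi> x) = character_of G \<tau>"
    using r(2) s(2) by (auto simp: fun_eq_iff \<rho>(2) \<sigma>(2) character_of_def \<tau>_def
        mat_trace_four_block[of _ d _ e])
  ultimately show ?thesis by (auto simp: is_character_def)
qed

lemma is_character_nat_mult:
  assumes \<phi>: "is_character G \<phi>" and "k > 0"
  shows "is_character G (\<lambda>x\<in>carrier G. of_nat k * \<phi> x)"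
  using \<open>k > 0\<close>
proof (induction k rule: nat_induct_non_zero)
  case 1
  have "(\<lambda>x\<in>carrier G. of_nat 1 * \<phi> x) = \<phi>"
    using \<phi> by (auto simp: is_character_def character_of_def fun_eq_iff)
  then show ?case using \<phi> by simp
next
  case (Suc k)
  have "(\<lambda>x\<in>carrier G. of_nat (Suc k) * \<phi> x)
      = (\<lambda>x\<in>carrier G. \<phi> x + (\<lambda>x\<in>carrier G. of_nat k * \<phi> x) x)"
    by (auto simp: fun_eq_iff distrib_right)
  then show ?case using is_character_add[OF \<phi> Suc.IH] by (simp only:)
qed

lemma is_character_sum:
  assumes "finite S" "S \<noteq> {}" "\<And>i. i \<in> S \<Longrightarrow> is_character G (\<phi> i)"
  shows "is_character G (\<lambda>x\<in>carrier G. \<Sum>i\<in>S. \<phi> i x)"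
  using assms
proof (induction S rule: finite_ne_induct)
  case (singleton i)
  have "(\<lambda>x\<in>carrier G. \<Sum>i\<in>{i}. \<phi> i x) = \<phi> i"
    using singleton[of i] by (auto simp: is_character_def character_of_def fun_eq_iff)
  then show ?case using singleton by simp
next
  case (insert i S)
  have "(\<lambda>x\<in>carrier G. \<Sum>i\<in>insert i S. \<phi> i x)
      = (\<lambda>x\<in>carrier G. \<phi> i x + (\<lambda>x\<in>carrier G. \<Sum>i\<in>S. \<phi> i x) x)"
    using insert by (auto simp: fun_eq_iff)
  moreover have "is_character G (\<phi> i)" using insert.prems by simp
  moreover have "is_character G (\<lambda>x\<in>carrier G. \<Sum>i\<in>S. \<phi> i x)"
    by (rule insert.IH) (use insert.prems in simp)
  ultimately show ?case by (simp only: is_character_add)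
qed

lemma Irr_is_character: "\<chi> \<in> Irr G \<Longrightarrow> is_character G \<chi>"
  using irreducible_representationD(1) by (auto simp: Irr_def is_character_def)

end

section \<open>Counting commutator products\<close>

context group
begin

lemma commutator_product_Nil: "commutator_product G [] = \<one>"
  by (simp add: commutator_product_def)

lemma commutator_product_Cons:
  "commutator_product G (p # ps) = commutator G (fst p) (snd p) \<otimes> commutator_product G ps"
  by (simp add: commutator_product_def case_prod_beta)

lemma commutator_closed: "x \<in> carrier G \<Longrightarrow> y \<in> carrier G \<Longrightarrow> commutator G x y \<in> carrier G"
  by (simp add: commutator_def)

lemma commutator_product_closed:
  "set ps \<subseteq> carrier G \<times> carrier G \<Longrightarrow> commutator_product G ps \<in> carrier G"
  by (induction ps) (auto simp: commutator_product_Nil commutator_product_Cons commutator_closed)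

end

context fin_group
begin

text \<open>Averaging \<open>\<rho> y\<close> over the group by conjugation gives the scalar \<open>\<chi> y / d\<close>.\<close>

lemma character_average:
  assumes \<rho>: "is_irreducible_representation G d \<rho>" and y: "y \<in> carrier G" and g: "g \<in> carrier G"
  shows "(\<Sum>x\<in>carrier G. character_of G \<rho> (x \<otimes> y \<otimes> inv x \<otimes> g))
    = of_nat (Coset.order G) * character_of G \<rho> y / of_nat d * character_of G \<rho> g"
proof -
  note r = representationD[OF irreducible_representationD(1)[OF \<rho>]]
  have c: "\<rho> x * \<rho> y * \<rho> (inv x) \<in> carrier_mat d d" if "x \<in> carrier G" for x
    using r(2) y that by (meson inv_closed mult_carrier_mat)
  have "(\<Sum>x\<in>carrier G. character_of G \<rho> (x \<otimes> y \<otimes> inv x \<otimes> g))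
      = (\<Sum>x\<in>carrier G. mat_trace (\<rho> x * \<rho> y * \<rho> (inv x) * \<rho> g))"
    using y g by (intro sum.cong) (auto simp: character_of_apply r(4))
  also have "\<dots> = mat_trace (mat_sum d d (\<lambda>x. \<rho> x * \<rho> y * \<rho> (inv x) * \<rho> g) (carrier G))"
    by (rule mat_trace_mat_sum[symmetric]) (rule mult_carrier_mat[OF c r(2)[OF g]])
  also have "mat_sum d d (\<lambda>x. \<rho> x * \<rho> y * \<rho> (inv x) * \<rho> g) (carrier G)
      = mat_sum d d (\<lambda>x. \<rho> x * \<rho> y * \<rho> (inv x)) (carrier G) * \<rho> g"
    using c r(2) g by (intro mat_sum_mult_right[symmetric]) auto
  also have "mat_sum d d (\<lambda>x. \<rho> x * \<rho> y * \<rho> (inv x)) (carrier G)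
      = (of_nat (Coset.order G) * mat_trace (\<rho> y) / of_nat d) \<cdot>\<^sub>m 1\<^sub>m d"
    by (rule average_scalar[OF \<rho> r(2)[OF y]])
  also have "\<dots> * \<rho> g = (of_nat (Coset.order G) * mat_trace (\<rho> y) / of_nat d) \<cdot>\<^sub>m \<rho> g"
    using r(2)[OF g] by (simp add: mult_smult_assoc_mat[of _ d d _ d])
  finally show ?thesis using y g r(2)[OF g] by (simp add: character_of_apply mat_trace_smult[of _ d])
qed

text \<open>Summed over all pairs, a commutator acts on an irreducible representation as a scalar.\<close>

lemma character_commutator_sum:
  assumes \<rho>: "is_irreducible_representation G d \<rho>" and H: "subgroup H G" "conj_invariant H"
    and g: "g \<in> carrier G"
  defines "\<chi> \<equiv> character_of G \<rho>"
  shows "(\<Sum>(h, x)\<in>H \<times> carrier G. \<chi> (commutator G h x \<otimes> g))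
    = of_nat (Coset.order G) * (\<Sum>h\<in>H. \<chi> h * cnj (\<chi> h)) / of_nat d ^ 2 * \<chi> g"
proof -
  note rep = irreducible_representationD(1)[OF \<rho>]
  have HG: "h \<in> carrier G" if "h \<in> H" for h using H(1) that by (rule subgroup.mem_carrier)
  have inv_conj: "inv (x \<otimes> h \<otimes> inv x) = x \<otimes> inv h \<otimes> inv x" if "x \<in> carrier G" "h \<in> carrier G" for x h
    using that by (simp add: inv_mult_group m_assoc)
  have pair: "(\<Sum>x\<in>carrier G. \<chi> (commutator G h x \<otimes> g))
      = of_nat (Coset.order G) / of_nat d * (cnj (\<chi> h) * \<chi> (h \<otimes> g))" if h: "h \<in> H" for h
  proof -
    note hG = HG[OF h]
    have "\<chi> (commutator G h x \<otimes> g) = \<chi> (x \<otimes> inv h \<otimes> inv x \<otimes> (g \<otimes> h))" if x: "x \<in> carrier G" for x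
      unfolding \<chi>_def using character_of_mult_commute[OF rep hG, of "x \<otimes> inv h \<otimes> inv x \<otimes> g"] x hG g
      by (simp add: commutator_def m_assoc)
    then have "(\<Sum>x\<in>carrier G. \<chi> (commutator G h x \<otimes> g))
        = (\<Sum>x\<in>carrier G. \<chi> (x \<otimes> inv h \<otimes> inv x \<otimes> (g \<otimes> h)))" by simp
    also have "\<dots> = of_nat (Coset.order G) * \<chi> (inv h) / of_nat d * \<chi> (g \<otimes> h)"
      unfolding \<chi>_def using hG g by (intro character_average[OF \<rho>]) auto
    finally show ?thesis
      unfolding \<chi>_def using character_inv[OF rep hG] character_of_mult_commute[OF rep hG g] by simp
  qed
  have "(\<Sum>(h, x)\<in>H \<times> carrier G. \<chi> (commutator G h x \<otimes> g))
      = of_nat (Coset.order G) / of_nat d * (\<Sum>h\<in>H. cnj (\<chi> h) * \<chi> (h \<otimes> g))"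
    by (simp add: sum.cartesian_product[symmetric] pair sum_distrib_left)
  also have "(\<Sum>h\<in>H. cnj (\<chi> h) * \<chi> (h \<otimes> g)) = (\<Sum>h\<in>H. cnj (\<chi> h) * \<chi> h) / of_nat d * \<chi> g"
    unfolding \<chi>_def
  proof (rule class_function_character_sum[OF \<rho> H(2) _ g])
    fix x h assume "x \<in> carrier G" "h \<in> H"
    then show "cnj (character_of G \<rho> (x \<otimes> h \<otimes> inv x)) = cnj (character_of G \<rho> h)"
      using character_of_conj[OF rep] HG by simp
  qed
  finally show ?thesis by (simp add: power2_eq_square mult_ac)
qed

lemma character_commutator_product_sum:
  assumes \<rho>: "is_irreducible_representation G d \<rho>" and H: "subgroup H G" "conj_invariant H"
    and g: "g \<in> carrier G"
  defines "\<chi> \<equiv> character_of G \<rho>"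
  shows "(\<Sum>ps | set ps \<subseteq> H \<times> carrier G \<and> length ps = n. \<chi> (commutator_product G ps \<otimes> g))
    = (of_nat (Coset.order G) * (\<Sum>h\<in>H. \<chi> h * cnj (\<chi> h)) / of_nat d ^ 2) ^ n * \<chi> g"
    (is "_ = ?c ^ n * _")
proof (induction n)
  case 0
  have "{ps. set ps \<subseteq> H \<times> carrier G \<and> length ps = 0} = {[]}" by auto
  then show ?case using g by (simp add: commutator_product_Nil)
next
  case (Suc n)
  let ?L = "\<lambda>n. {ps. set ps \<subseteq> H \<times> carrier G \<and> length ps = n}"
  have HG: "H \<subseteq> carrier G" using subgroup.subset[OF H(1)] .
  have "(\<Sum>ps\<in>?L (Suc n). \<chi> (commutator_product G ps \<otimes> g))
      = (\<Sum>(ps, p)\<in>?L n \<times> (H \<times> carrier G). \<chi> (commutator_product G (p # ps) \<otimes> g))"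
    unfolding lists_length_Suc_eq
    by (subst sum.reindex) (auto simp: inj_on_def case_prod_beta intro!: sum.cong)
  also have "\<dots> = (\<Sum>ps\<in>?L n. \<Sum>p\<in>H \<times> carrier G. \<chi> (commutator_product G (p # ps) \<otimes> g))"
    by (rule sum.cartesian_product[symmetric])
  also have "\<dots> = (\<Sum>ps\<in>?L n. \<Sum>(h, x)\<in>H \<times> carrier G. \<chi> (commutator G h x \<otimes> (commutator_product G ps \<otimes> g)))"
  proof (intro sum.cong refl)
    fix ps p assume "ps \<in> ?L n" "p \<in> H \<times> carrier G"
    then have "commutator_product G ps \<in> carrier G" "commutator G (fst p) (snd p) \<in> carrier G"
      using HG by (auto intro!: commutator_product_closed commutator_closed)
    then show "\<chi> (commutator_product G (p # ps) \<otimes> g)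
        = (case p of (h, x) \<Rightarrow> \<chi> (commutator G h x \<otimes> (commutator_product G ps \<otimes> g)))"
      using g by (simp add: commutator_product_Cons m_assoc case_prod_beta)
  qed
  also have "\<dots> = (\<Sum>ps\<in>?L n. ?c * \<chi> (commutator_product G ps \<otimes> g))"
    unfolding \<chi>_def using HG g
    by (intro sum.cong refl character_commutator_sum[OF \<rho> H] m_closed commutator_product_closed) auto
  also have "\<dots> = ?c ^ Suc n * \<chi> g"
    unfolding sum_distrib_left[symmetric] Suc.IH by (simp add: mult_ac)
  finally show ?case .
qed

theorem zeta_formula:
  assumes H: "subgroup H G" "conj_invariant H" and n: "n \<ge> 1" and g: "g \<in> carrier G"
  shows "of_nat (zeta G H n g) = (\<Sum>\<chi>\<in>Irr G.
      of_nat (Coset.order G) ^ (n - 1) * of_nat (card H) ^ n *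
      class_inner (G\<lparr>carrier := H\<rparr>) (restrict \<chi> H) (restrict \<chi> H) ^ n / \<chi> \<one> ^ (2 * n - 1) * \<chi> g)"
proof -
  let ?N = "of_nat (Coset.order G) :: complex"
  let ?L = "{ps. set ps \<subseteq> H \<times> carrier G \<and> length ps = n}"
  define b where "b \<chi> = ?N ^ (n - 1) * of_nat (card H) ^ n *
      class_inner (G\<lparr>carrier := H\<rparr>) (restrict \<chi> H) (restrict \<chi> H) ^ n / \<chi> \<one> ^ (2 * n - 1)" for \<chi>
  have N0: "?N \<noteq> 0" using order_pos by simp
  have HG: "H \<subseteq> carrier G" using subgroup.subset[OF H(1)] .
  have finL: "finite ?L"
    using HG fin by (intro finite_lists_length_eq) (auto intro: finite_subset)
  have closed: "commutator_product G ps \<in> carrier G" if "ps \<in> ?L" for ps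
    using that HG by (intro commutator_product_closed) auto
  \<comment> \<open>The sums below produce \<open>\<chi> (inv g)\<close>, the conjugate of \<open>\<chi> g\<close>; the coefficients \<open>b \<chi>\<close> are real, so
    conjugating at the end gives \<open>\<chi> g\<close>.\<close>
  have irr: "(\<Sum>ps\<in>?L. \<chi> \<one> * \<chi> (commutator_product G ps \<otimes> inv g)) = ?N * cnj (b \<chi> * \<chi> g)"
    if \<chi>: "\<chi> \<in> Irr G" for \<chi>
  proof -
    obtain d \<rho> where \<rho>: "is_irreducible_representation G d \<rho>" and \<chi>\<rho>: "\<chi> = character_of G \<rho>"
      using \<chi> by (auto simp: Irr_def)
    note rep = irreducible_representationD(1)[OF \<rho>]
    have d: "\<chi> \<one> = of_nat d" "d > 0"
      using character_of_one[OF rep] representationD(1)[OF rep] by (auto simp: \<chi>\<rho>)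
    let ?m = "class_inner (G\<lparr>carrier := H\<rparr>) (restrict \<chi> H) (restrict \<chi> H)"
    obtain k where k: "?m = of_nat k"
      using restricted_character_norm_nat[OF rep H(1)] by (auto simp: \<chi>\<rho>)
    have norm: "(\<Sum>h\<in>H. \<chi> h * cnj (\<chi> h)) = of_nat (card H) * of_nat k"
      using restricted_norm_sum[OF H(1), of \<chi>] k by simp
    have b_real: "cnj (b \<chi>) = b \<chi>" by (simp add: b_def k d(1))
    obtain n' where n': "n = Suc n'" using n by (cases n) auto
    have "(\<Sum>ps\<in>?L. \<chi> \<one> * \<chi> (commutator_product G ps \<otimes> inv g))
        = of_nat d * (?N * (of_nat (card H) * of_nat k) / of_nat d ^ 2) ^ n * \<chi> (inv g)"
      using character_commutator_product_sum[OF \<rho> H inv_closed[OF g], of n]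
      by (simp add: sum_distrib_left[symmetric] \<chi>\<rho>[symmetric] norm d(1))
    also have "of_nat d * (?N * (of_nat (card H) * of_nat k) / of_nat d ^ 2) ^ n = ?N * b \<chi>"
      using d(2) by (simp add: b_def k d(1) n' power_mult_distrib power_divide field_simps
          power_mult[symmetric] power2_eq_square mult_2_right flip: power_add)
    finally show ?thesis
      using character_inv[OF rep g] b_real by (simp add: \<chi>\<rho>)
  qed
  have "?N * of_nat (zeta G H n g) = (\<Sum>ps\<in>?L. if commutator_product G ps = g then ?N else 0)"
    using finL by (simp add: zeta_def sum.If_cases Int_def conj_ac)
  also have "\<dots> = (\<Sum>ps\<in>?L. \<Sum>\<chi>\<in>Irr G. \<chi> \<one> * \<chi> (commutator_product G ps \<otimes> inv g))"
  proof (rule sum.cong)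
    fix ps assume "ps \<in> ?L"
    note c = closed[OF this]
    have "commutator_product G ps \<otimes> inv g = \<one> \<longleftrightarrow> commutator_product G ps = g"
      using c g by (metis inv_closed inv_equality inv_inv r_inv)
    then show "(if commutator_product G ps = g then ?N else 0)
        = (\<Sum>\<chi>\<in>Irr G. \<chi> \<one> * \<chi> (commutator_product G ps \<otimes> inv g))"
      using sum_Irr_degree[of "commutator_product G ps \<otimes> inv g"] c g by simp
  qed simp
  also have "\<dots> = (\<Sum>\<chi>\<in>Irr G. ?N * cnj (b \<chi> * \<chi> g))"
    by (subst sum.swap) (simp add: irr)
  also have "\<dots> = ?N * cnj (\<Sum>\<chi>\<in>Irr G. b \<chi> * \<chi> g)" by (simp add: sum_distrib_left)
  finally have "of_nat (zeta G H n g) = cnj (\<Sum>\<chi>\<in>Irr G. b \<chi> * \<chi> g)" using N0 by simp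
  then have "cnj (of_nat (zeta G H n g)) = (\<Sum>\<chi>\<in>Irr G. b \<chi> * \<chi> g)" by (metis complex_cnj_cnj)
  then show ?thesis by (simp add: b_def)
qed

text \<open>The coefficients factor as \<open>(|G| / \<chi> 1) ^ (n - 1) * (|H| [\<chi>\<^sub>H, \<chi>\<^sub>H] / \<chi> 1) ^ n\<close>, a product of
  positive natural numbers.\<close>

theorem zeta_is_character:
  assumes H: "subgroup H G" "conj_invariant H" and n: "n \<ge> 1"
  shows "is_character G (\<lambda>g\<in>carrier G. of_nat (zeta G H n g))"
proof -
  define b where "b \<chi> = of_nat (Coset.order G) ^ (n - 1) * of_nat (card H) ^ n *
      class_inner (G\<lparr>carrier := H\<rparr>) (restrict \<chi> H) (restrict \<chi> H) ^ n / \<chi> \<one> ^ (2 * n - 1)" for \<chi>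
  have "\<exists>k>0. b \<chi> = of_nat k" if \<chi>: "\<chi> \<in> Irr G" for \<chi>
  proof -
    obtain m where m: "m > 0"
      "of_nat (card H) * class_inner (G\<lparr>carrier := H\<rparr>) (restrict \<chi> H) (restrict \<chi> H) / \<chi> \<one> = of_nat m"
      using coefficient_nat[OF \<chi> H] by blast
    obtain l where l: "l > 0" "of_nat (Coset.order G) / \<chi> \<one> = of_nat l"
      using degree_dvd_order[OF \<chi>] by blast
    have "2 * n - 1 = (n - 1) + n" using n by simp
    then have "b \<chi> = (of_nat (Coset.order G) / \<chi> \<one>) ^ (n - 1) *
        (of_nat (card H) * class_inner (G\<lparr>carrier := H\<rparr>) (restrict \<chi> H) (restrict \<chi> H) / \<chi> \<one>) ^ n"
      by (simp add: b_def power_add power_divide power_mult_distrib)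
    also have "\<dots> = of_nat (l ^ (n - 1) * m ^ n)" unfolding m(2) l(2) by simp
    finally show ?thesis using m(1) l(1) by (metis nat_0_less_mult_iff zero_less_power)
  qed
  then obtain k where k: "\<And>\<chi>. \<chi> \<in> Irr G \<Longrightarrow> k \<chi> > 0 \<and> b \<chi> = of_nat (k \<chi>)" by metis
  have "of_nat (zeta G H n g) = (\<Sum>\<chi>\<in>Irr G. b \<chi> * \<chi> g)" if "g \<in> carrier G" for g
    using zeta_formula[OF H n that] by (simp only: b_def)
  then have eq: "(\<lambda>g\<in>carrier G. of_nat (zeta G H n g))
      = (\<lambda>g\<in>carrier G. \<Sum>\<chi>\<in>Irr G. (\<lambda>x\<in>carrier G. of_nat (k \<chi>) * \<chi> x) g)"
    using k by (auto simp: fun_eq_iff intro!: sum.cong)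
  show ?thesis
    unfolding eq using k
    by (intro is_character_sum finite_Irr Irr_nonempty is_character_nat_mult Irr_is_character) auto
qed

end

theorem proposition3p3p3:
  fixes G :: "('a, 'b) monoid_scheme" and H :: "'a set" and n :: nat
  assumes "group G" and "finite (carrier G)" and "H \<lhd> G" and "n \<ge> 1"
  shows "is_character G (\<lambda>g\<in>carrier G. of_nat (zeta G H n g)) \<and>
    (\<forall>g\<in>carrier G. of_nat (zeta G H n g) =
      (\<Sum>\<chi>\<in>Irr G.
         of_nat (Coset.order G) ^ (n - 1) * of_nat (card H) ^ n *
         class_inner (G\<lparr>carrier := H\<rparr>) (restrict \<chi> H) (restrict \<chi> H) ^ n /
         \<chi> \<one>\<^bsub>G\<^esub> ^ (2 * n - 1) * \<chi> g))"
proof -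
  interpret fin_group G using assms by (simp add: fin_group_def fin_group_axioms_def)
  have H: "subgroup H G" using assms(3) by (rule normal_imp_subgroup)
  have "conj_invariant H"
    using normal_inv_iff[THEN iffD1, OF assms(3)] subgroup.subset[OF H] by (auto simp: conj_invariant_def)
  then show ?thesis
    using zeta_is_character[OF H _ assms(4)] zeta_formula[OF H _ assms(4)] by blast
qed

end
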